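(* Let $m,n,r$ be positive integers with $r \le \min(m,n)$. Let $\mathbf{B} = \mathbf{A} + \mathbf{Z}$, where $\mathbf{A},\mathbf{Z} \in \mathbb{R}^{m\times n}$ and $\mathrm{rank}(\mathbf{A}) = r$. Let $\widehat{\mathbf{U}}\in\mathbb{R}^{m\times r}$ and $\widehat{\mathbf{V}}\in\mathbb{R}^{n\times r}$ be the matrices of the leading $r$ left and right singular vectors of $\mathbf{B}$, with orthonormal complements $\widehat{\mathbf{U}}_\perp$ and $\widehat{\mathbf{V}}_\perp$. Then for any $q\in[1,\infty]$, $$\max\left\{\|P_{\widehat{\mathbf{U}}_\perp}\mathbf{A}\|_q,\ \|\mathbf{A}P_{\widehat{\mathbf{V}}_\perp}\|_q\right\} \le 2\,\|\mathbf{Z}_{\max(r)}\|_q.$$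
   Context: For $\mathbf{M}\in\mathbb{R}^{m\times n}$ with singular values $\sigma_1(\mathbf{M})\ge\cdots\ge\sigma_{\min(m,n)}(\mathbf{M})\ge 0$, the Schatten-$q$ norm is $\|\mathbf{M}\|_q = \left(\sum_{i=1}^{\min(m,n)} \sigma_i(\mathbf{M})^q\right)^{1/q}$ for $1\le q<\infty$, and $\|\mathbf{M}\|_\infty = \sigma_1(\mathbf{M})$ is the spectral norm. Given a singular value decomposition $\mathbf{M} = \sum_{i}\sigma_i(\mathbf{M})\mathbf{u}_i\mathbf{v}_i^\top$, $\mathbf{M}_{\max(r)} = \sum_{i=1}^r \sigma_i(\mathbf{M})\mathbf{u}_i\mathbf{v}_i^\top$. The singular value decomposition of $\mathbf{B}$ (singular values in decreasing order) is written $$\mathbf{B} = [\widehat{\mathbf{U}}\ \ \widehat{\mathbf{U}}_\perp]\begin{bmatrix}\widehat{\boldsymbol{\Sigma}}_1 & 0\\ 0& \widehat{\boldsymbol{\Sigma}}_2\end{bmatrix}\begin{bmatrix}\widehat{\mathbf{V}}^\top\\ \widehat{\mathbf{V}}_\perp^\top\end{bmatrix},$$ with $[\widehat{\mathbf{U}}\ \widehat{\mathbf{U}}_\perp]$ and $[\widehat{\mathbf{V}}\ \widehat{\mathbf{V}}_\perp]$ orthogonal and $\widehat{\boldsymbol{\Sigma}}_1$ the $r\times r$ diagonal matrix of the $r$ largest singular values of $\mathbf{B}$. For a matrix $\mathbf{W}$ with orthonormal columns, $P_{\mathbf{W}} = \mathbf{W}\mathbf{W}^\top$ is the orthogonal projection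 onto its column span. *)

theory Defs
  imports
    "Jordan_Normal_Form.Char_Poly"
    "Jordan_Normal_Form.DL_Rank"
    "HOL-Library.Extended_Real"
begin

definition orthonormal_cols :: "real mat \<Rightarrow> bool" where
  "orthonormal_cols W \<longleftrightarrow> W\<^sup>T * W = 1\<^sub>m (dim_col W)"

definition proj_onto :: "real mat \<Rightarrow> real mat" where
  "proj_onto W = W * W\<^sup>T"

definition append_cols :: "'a :: zero mat \<Rightarrow> 'a mat \<Rightarrow> 'a mat" where
  "append_cols A B = four_block_mat A B (0\<^sub>m 0 (dim_col A)) (0\<^sub>m 0 (dim_col B))"

text \<open>
  The singular values are the square roots of the eigenvalues of \<open>M\<^sup>T * M\<close>, with
  multiplicity and in decreasing order. There are \<open>dim_col M\<close> such eigenvalues; if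
  \<open>dim_row M < dim_col M\<close> the trailing ones are zero and are dropped. Lemma
  \<open>singular_values_eq\<close> below identifies this list with the diagonal of any singular value
  decomposition.
\<close>
definition singular_values :: "real mat \<Rightarrow> real list" where
  "singular_values M =
     take (min (dim_row M) (dim_col M))
       (rev (sorted_list_of_multiset (image_mset sqrt (proots (char_poly (M\<^sup>T * M))))))"

text \<open>For the empty matrix the spectral norm is an arbitrary value.\<close>
definition schatten_norm :: "ereal \<Rightarrow> real mat \<Rightarrow> real" where
  "schatten_norm q M =
     (if q = \<infinity> then singular_values M ! 0
      else (\<Sum>\<sigma>\<leftarrow>singular_values M. \<sigma> powr real_of_ereal q) powr (1 / real_of_ereal q))"

definition rect_diag :: "nat \<Rightarrow> nat \<Rightarrow> real list \<Rightarrow> real mat" where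
  "rect_diag m n s = mat m n (\<lambda>(i, j). if i = j then s ! i else 0)"

text \<open>A full decomposition \<open>M = U * \<Sigma> * V\<^sup>T\<close>, with the diagonal of \<open>\<Sigma>\<close> given as a list.\<close>
definition is_svd :: "real mat \<Rightarrow> real mat \<Rightarrow> real list \<Rightarrow> real mat \<Rightarrow> bool" where
  "is_svd M U s V \<longleftrightarrow>
     U \<in> carrier_mat (dim_row M) (dim_row M) \<and> orthonormal_cols U \<and>
     V \<in> carrier_mat (dim_col M) (dim_col M) \<and> orthonormal_cols V \<and>
     length s = min (dim_row M) (dim_col M) \<and>
     sorted_wrt (\<ge>) s \<and> (\<forall>x\<in>set s. 0 \<le> x) \<and>
     M = U * rect_diag (dim_row M) (dim_col M) s * V\<^sup>T"

lemma singular_values_eq: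
  assumes svd: "is_svd M U s V"
  shows "singular_values M = s"
proof -
  define m where "m = dim_row M"
  define n where "n = dim_col M"
  define D where "D = rect_diag m n s"
  define d where "d = s @ replicate (n - min m n) 0"
  have U: "U \<in> carrier_mat m m" and V: "V \<in> carrier_mat n n"
    and UU: "U\<^sup>T * U = 1\<^sub>m m" and VV: "V\<^sup>T * V = 1\<^sub>m n"
    and len: "length s = min m n" and desc: "sorted_wrt (\<ge>) s" and nonneg: "\<forall>x\<in>set s. 0 \<le> x"
    and M: "M = U * D * V\<^sup>T"
    using svd by (auto simp: is_svd_def orthonormal_cols_def m_def n_def D_def)
  have D: "D \<in> carrier_mat m n"
    by (simp add: D_def rect_diag_def)
  have VV': "V * V\<^sup>T = 1\<^sub>m n"
    using mat_mult_left_right_inverse[OF _ V VV] V by simp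
  have "M\<^sup>T = V * (D\<^sup>T * U\<^sup>T)"
    unfolding M using U V D by (simp add: transpose_mult[of _ m n _ n] transpose_mult[of _ m m _ n])
  hence "M\<^sup>T * M = (V * (D\<^sup>T * U\<^sup>T)) * (U * (D * V\<^sup>T))"
    using M U V D by (simp add: assoc_mult_mat[of _ m m _ n _ n])
  also have "\<dots> = V * (D\<^sup>T * ((U\<^sup>T * U) * (D * V\<^sup>T)))"
    using U V D by (simp add: assoc_mult_mat[of _ n n _ m _ n] assoc_mult_mat[of _ n m _ m _ n]
        assoc_mult_mat[of _ m m _ m _ n])
  also have "\<dots> = V * (D\<^sup>T * D) * V\<^sup>T"
    using U V D by (simp add: UU assoc_mult_mat[of _ n n _ n _ n] assoc_mult_mat[of _ n m _ n _ n]
        left_mult_one_mat[of _ m n])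
  finally have sim: "M\<^sup>T * M = V * (D\<^sup>T * D) * V\<^sup>T" .
  have "similar_mat (M\<^sup>T * M) (D\<^sup>T * D)"
    unfolding similar_mat_def similar_mat_wit_def Let_def
    using V D VV VV' sim m_def n_def by (intro exI[of _ V] exI[of _ "V\<^sup>T"]) auto
  hence "char_poly (M\<^sup>T * M) = char_poly (D\<^sup>T * D)"
    by (rule char_poly_similar)
  have entry: "(D\<^sup>T * D) $$ (i, j) = (if i = j then (d ! i)\<^sup>2 else 0)" if "i < n" "j < n" for i j
  proof -
    have "(D\<^sup>T * D) $$ (i, j) = (\<Sum>k<m. D $$ (k, i) * D $$ (k, j))"
      using D that by (simp add: scalar_prod_def atLeast0LessThan)
    also have "\<dots> = (\<Sum>k<m. if k = i then (if i = j then (s ! i)\<^sup>2 else 0) else 0)"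
      using that by (intro sum.cong) (auto simp: D_def rect_diag_def power2_eq_square)
    also have "\<dots> = (if i = j then (d ! i)\<^sup>2 else 0)"
      using that len by (auto simp: d_def nth_append)
    finally show ?thesis .
  qed
  have len_d: "length d = n"
    using len by (simp add: d_def)
  have diag: "diag_mat (D\<^sup>T * D) = map (\<lambda>x. x\<^sup>2) d"
    using D len_d by (auto simp: diag_mat_def entry intro!: nth_equalityI)
  have "upper_triangular (D\<^sup>T * D)"
    using D entry by auto
  hence "char_poly (D\<^sup>T * D) = (\<Prod>a\<leftarrow>map (\<lambda>x. x\<^sup>2) d. [:- a, 1:])"
    using char_poly_upper_triangular[of "D\<^sup>T * D" n] D diag by simp
  hence "proots (char_poly (M\<^sup>T * M)) = proots (\<Prod>a\<leftarrow>map (\<lambda>x. x\<^sup>2) d. [:- a, 1:])"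
    using \<open>char_poly (M\<^sup>T * M) = _\<close> by simp
  also have "\<dots> = mset (map (\<lambda>x. x\<^sup>2) d)"
  proof (induction d)
    case (Cons x xs)
    define p where "p = (\<Prod>a\<leftarrow>map (\<lambda>x. x\<^sup>2) xs. [:- a, 1:])"
    have "p \<noteq> 0"
      by (auto simp: p_def prod_list_zero_iff)
    hence "proots ([:- (x\<^sup>2), 1:] * p) = proots [:- (x\<^sup>2), 1:] + proots p"
      by (intro proots_mult) auto
    with Cons show ?case
      by (simp add: p_def del: mult_pCons_left)
  qed simp
  finally have "image_mset sqrt (proots (char_poly (M\<^sup>T * M))) = mset (map sqrt (map (\<lambda>x. x\<^sup>2) d))"
    by (simp only: mset_map)
  also have "map sqrt (map (\<lambda>x. x\<^sup>2) d) = d"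
    using nonneg by (auto simp: d_def intro!: map_idI)
  finally have "image_mset sqrt (proots (char_poly (M\<^sup>T * M))) = mset (rev d)"
    by simp
  moreover have "sorted (rev d)"
    using desc nonneg by (auto simp: d_def sorted_wrt_rev sorted_wrt_append)
  ultimately have "sorted_list_of_multiset (image_mset sqrt (proots (char_poly (M\<^sup>T * M)))) = rev d"
    by (metis sorted_list_of_multiset_mset sorted_sort_id)
  thus ?thesis
    using len by (simp add: singular_values_def d_def m_def n_def)
qed

text \<open>
  The sum of the first \<open>r\<close> rank-one terms of a singular value decomposition, that is
  \<open>M\<^bsub>max(r)\<^esub>\<close> for the matrix \<open>M\<close> decomposed by \<open>U\<close>, \<open>s\<close>, \<open>V\<close>. If the \<open>r\<close>-th and
  \<open>r+1\<close>-st singular values of \<open>M\<close> coincide, this depends on the decomposition.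
\<close>
definition svd_trunc :: "nat \<Rightarrow> real mat \<Rightarrow> real list \<Rightarrow> real mat \<Rightarrow> real mat" where
  "svd_trunc r U s V =
     mat (dim_row U) (dim_row V) (\<lambda>(a, b). \<Sum>i<r. s ! i * col U i $ a * col V i $ b)"

end

theory Submission
  imports Defs "Jordan_Normal_Form.Spectral_Radius"
begin

text \<open>
  Let \<open>M\<close> be one of the two matrices \<open>P * A\<close>, \<open>A * P\<close>, where \<open>P\<close> is the respective projection onto
  the complement of the leading singular vectors of \<open>B\<close>, with singular values \<open>\<sigma>\<^sub>i > 0\<close> and
  singular vectors \<open>u\<^sub>i\<close>, \<open>v\<^sub>i\<close>. On the left \<open>P * u\<^sub>i = u\<^sub>i\<close>, on the right \<open>P * v\<^sub>i = v\<^sub>i\<close>; in both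
  cases \<open>u\<^sub>j \<bullet> (A * v\<^sub>i)\<close> is \<open>\<sigma>\<^sub>i\<close> for \<open>i = j\<close> and zero otherwise. Hence there are at most
  \<open>rank A = r\<close> indices \<open>i\<close> (\<open>orthonormal_family_card_le_rank\<close>), and
  \<open>\<sigma>\<^sub>i = u\<^sub>i \<bullet> (B * v\<^sub>i) - u\<^sub>i \<bullet> (Z * v\<^sub>i)\<close>.

  For two orthonormal families of at most \<open>r\<close> vectors, the numbers \<open>\<bar>u\<^sub>i \<bullet> (Z * v\<^sub>i)\<bar>\<close> have an
  \<open>\<ell>\<^sub>q\<close>-norm of at most that of the \<open>r\<close> largest singular values of \<open>Z\<close>: in terms of a singular
  value decomposition they are dominated by the image of the singular values under a doubly
  substochastic matrix, and Jensen's inequality for \<open>t powr q\<close> applies (\<open>sum_powr_bilinear_le\<close>).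
  The same estimate holds for \<open>B\<close>, but here the first \<open>r\<close> terms of the decomposition vanish,
  because \<open>u\<^sub>i\<close> or \<open>v\<^sub>i\<close> is orthogonal to the leading singular vectors of \<open>B\<close>. The remaining
  singular values satisfy \<open>s\<^bsub>r+k\<^esub>(B) \<le> s\<^sub>k(Z)\<close>, which is Weyl's inequality for a perturbation of rank
  \<open>r\<close> (\<open>singular_value_low_rank_perturbation\<close>). So both contributions are bounded by the norm of
  the truncation of \<open>Z\<close>, which gives the factor 2.

  That the singular values of \<open>M\<close>, defined by the characteristic polynomial of \<open>M\<^sup>T * M\<close>, come with
  singular vectors rests on the spectral theorem for real symmetric matrices
  (\<open>spectral_theorem_symmetric_real\<close>).
\<close>

section \<open>Inequalities for weighted sums and powers\<close>

text \<open>
  The convex function \<open>x powr q\<close> lies above its tangent at \<open>c\<close>. With \<open>t = x / c\<close> this is Bernoulli's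
  inequality \<open>1 + q * (t - 1) \<le> t powr q\<close>, which follows from \<open>1 + z \<le> exp z\<close> and \<open>1 - 1/t \<le> ln t\<close>.
\<close>
lemma powr_tangent:
  fixes c x q :: real
  assumes "0 < c" "0 \<le> x" "1 \<le> q"
  shows "c powr q * (1 + q * (x / c - 1)) \<le> x powr q"
proof (cases "x = 0")
  case True
  then show ?thesis
    using assms by (simp add: mult_nonneg_nonpos)
next
  case False
  define t where "t = x / c"
  have t: "0 < t"
    using False assms by (simp add: t_def)
  have "1 - 1 / t \<le> ln t"
    using ln_le_minus_one[of "1 / t"] t by (simp add: ln_div)
  hence "1 + (q - 1) * (1 - 1 / t) \<le> 1 + (q - 1) * ln t"
    using assms by (intro add_left_mono mult_left_mono) auto
  also have "\<dots> \<le> exp ((q - 1) * ln t)"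
    by (rule exp_ge_add_one_self)
  also have "\<dots> = t powr (q - 1)"
    using t by (simp add: powr_def)
  finally have "t * (1 + (q - 1) * (1 - 1 / t)) \<le> t * t powr (q - 1)"
    using t by (intro mult_left_mono) auto
  also have "t * t powr (q - 1) = t powr q"
    using t by (simp add: powr_mult_base)
  also have "t * (1 + (q - 1) * (1 - 1 / t)) = 1 + q * (t - 1)"
    using t by (simp add: field_simps)
  finally have "c powr q * (1 + q * (t - 1)) \<le> c powr q * t powr q"
    by (intro mult_left_mono) auto
  also have "\<dots> = x powr q"
    using assms t by (simp add: t_def flip: powr_mult)
  finally show ?thesis
    by (simp add: t_def)
qed

text \<open>
  Jensen's inequality for subprobability weights; the missing mass may be thought of as placed at \<open>0\<close>.
\<close>
lemma powr_sum_le: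
  fixes w s :: "'k \<Rightarrow> real" and q :: real
  assumes "1 \<le> q" "\<And>k. k \<in> K \<Longrightarrow> 0 \<le> w k" "\<And>k. k \<in> K \<Longrightarrow> 0 \<le> s k" "(\<Sum>k\<in>K. w k) \<le> 1"
  shows "(\<Sum>k\<in>K. w k * s k) powr q \<le> (\<Sum>k\<in>K. w k * s k powr q)"
proof -
  define c where "c = (\<Sum>k\<in>K. w k * s k)"
  define W where "W = (\<Sum>k\<in>K. w k)"
  have "0 \<le> c"
    unfolding c_def using assms by (intro sum_nonneg) auto
  show ?thesis
  proof (cases "c = 0")
    case True
    then show ?thesis
      using assms by (auto simp: c_def intro!: sum_nonneg)
  next
    case False
    hence c: "0 < c"
      using \<open>0 \<le> c\<close> by simp
    have "(q - 1) * W \<le> (q - 1) * 1"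
      using assms by (intro mult_left_mono) (auto simp: W_def)
    hence "c powr q * 1 \<le> c powr q * (W + q * (1 - W))"
      by (intro mult_left_mono) (auto simp: algebra_simps)
    hence "c powr q \<le> c powr q * (W + q * (1 - W))"
      by simp
    also have "W + q * (1 - W) = (\<Sum>k\<in>K. w k * (1 + q * (s k / c - 1)))"
    proof -
      have "(\<Sum>k\<in>K. w k * (1 + q * (s k / c - 1))) = (\<Sum>k\<in>K. w k + q / c * (w k * s k) - q * w k)"
        by (intro sum.cong) (auto simp: algebra_simps)
      also have "\<dots> = W + q / c * c - q * W"
        by (simp only: sum.distrib sum_subtractf W_def c_def flip: sum_distrib_left)
      finally show ?thesis
        using c by (simp add: algebra_simps)
    qed
    also have "c powr q * \<dots> = (\<Sum>k\<in>K. w k * (c powr q * (1 + q * (s k / c - 1))))"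
      by (simp add: sum_distrib_left mult_ac)
    also have "\<dots> \<le> (\<Sum>k\<in>K. w k * s k powr q)"
      using assms c by (intro sum_mono mult_left_mono powr_tangent) auto
    finally show ?thesis
      by (simp add: c_def)
  qed
qed

lemma powr_diff_le:
  fixes x y q :: real
  assumes "1 \<le> q"
  shows "\<bar>x - y\<bar> powr q \<le> 2 powr q * ((\<bar>x\<bar> powr q + \<bar>y\<bar> powr q) / 2)"
proof -
  have "\<bar>x - y\<bar> powr q \<le> (2 * (\<bar>x\<bar> / 2 + \<bar>y\<bar> / 2)) powr q"
    using assms by (intro powr_mono2) auto
  also have "\<dots> = 2 powr q * (\<bar>x\<bar> / 2 + \<bar>y\<bar> / 2) powr q"
    by (rule powr_mult)
  also have "(\<bar>x\<bar> / 2 + \<bar>y\<bar> / 2) powr q \<le> \<bar>x\<bar> powr q / 2 + \<bar>y\<bar> powr q / 2"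
    using powr_sum_le[of q "UNIV :: bool set" "\<lambda>_. 1 / 2" "\<lambda>b. if b then \<bar>x\<bar> else \<bar>y\<bar>"] assms
    by (simp add: UNIV_bool algebra_simps)
  finally show ?thesis
    by (simp add: add_divide_distrib)
qed

text \<open>
  A sum of decreasing nonnegative terms with weights in \<open>[0, 1]\<close> of total mass at most \<open>r\<close> is largest when the
  weight sits on the first \<open>r\<close> terms.
\<close>
lemma sum_weighted_le_sum_largest:
  fixes t c :: "nat \<Rightarrow> real"
  assumes dec: "\<And>j k. j \<le> k \<Longrightarrow> k < N \<Longrightarrow> t k \<le> t j" and t: "\<And>k. k < N \<Longrightarrow> 0 \<le> t k"
    and c: "\<And>k. k < N \<Longrightarrow> 0 \<le> c k" "\<And>k. k < N \<Longrightarrow> c k \<le> 1" and sum: "(\<Sum>k<N. c k) \<le> real r"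
  shows "(\<Sum>k<N. c k * t k) \<le> (\<Sum>k<min r N. t k)"
proof (cases "r < N")
  case False
  thus ?thesis
    using mult_right_mono[OF c(2) t] by (auto simp: min_def intro!: sum_mono)
next
  case True
  \<comment> \<open>Subtracting \<open>t r\<close> makes the terms nonnegative before position \<open>r\<close> and nonpositive after it.\<close>
  have "(\<Sum>k<N. c k * (t k - t r)) \<le> (\<Sum>k<N. if k < r then t k - t r else 0)"
  proof (rule sum_mono)
    fix k assume "k \<in> {..<N}"
    thus "c k * (t k - t r) \<le> (if k < r then t k - t r else 0)"
      using c[of k] dec[of k r] dec[of r k] True mult_right_mono[of "c k" 1 "t k - t r"]
      by (auto simp: mult_le_0_iff)
  qed
  also have "\<dots> = (\<Sum>k<r. t k - t r)"
    using True by (simp add: sum.If_cases Int_absorb1 flip: lessThan_def)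
  finally have "(\<Sum>k<N. c k * t k) - t r * (\<Sum>k<N. c k) \<le> (\<Sum>k<r. t k) - real r * t r"
    by (simp add: right_diff_distrib sum_subtractf sum_distrib_left mult_ac)
  moreover have "t r * (\<Sum>k<N. c k) \<le> t r * real r"
    using t[OF True] sum by (intro mult_left_mono)
  ultimately show ?thesis
    using True by (simp add: mult_ac)
qed

lemma abs_sum_prod_le_weighted:
  fixes s g h :: "nat \<Rightarrow> real"
  assumes "\<And>k. k < N \<Longrightarrow> 0 \<le> s k"
  shows "\<bar>\<Sum>k<N. s k * g k * h k\<bar> \<le> (\<Sum>k<N. ((g k)\<^sup>2 + (h k)\<^sup>2) / 2 * s k)"
proof -
  have "\<bar>\<Sum>k<N. s k * g k * h k\<bar> \<le> (\<Sum>k<N. \<bar>s k * g k * h k\<bar>)"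
    by (rule sum_abs)
  also have "\<dots> \<le> (\<Sum>k<N. ((g k)\<^sup>2 + (h k)\<^sup>2) / 2 * s k)"
  proof (rule sum_mono)
    fix k assume "k \<in> {..<N}"
    have "\<bar>g k * h k\<bar> \<le> ((g k)\<^sup>2 + (h k)\<^sup>2) / 2"
      using sum_squares_bound[of "\<bar>g k\<bar>" "\<bar>h k\<bar>"] by (simp add: abs_mult)
    hence "\<bar>g k * h k\<bar> * s k \<le> ((g k)\<^sup>2 + (h k)\<^sup>2) / 2 * s k"
      using assms \<open>k \<in> {..<N}\<close> by (intro mult_right_mono) auto
    thus "\<bar>s k * g k * h k\<bar> \<le> ((g k)\<^sup>2 + (h k)\<^sup>2) / 2 * s k"
      using assms \<open>k \<in> {..<N}\<close> by (simp add: abs_mult mult_ac)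
  qed
  finally show ?thesis .
qed

text \<open>
  The row and column conditions say that \<open>((g i k)\<^sup>2 + (h i k)\<^sup>2) / 2\<close> is a doubly substochastic
  matrix. If \<open>g i k\<close> and \<open>h i k\<close> are the coordinates of orthonormal vectors \<open>u\<^sub>i\<close> and \<open>v\<^sub>i\<close> with respect to
  the singular vectors of a matrix with singular values \<open>s\<close>, then the inner sums on the left
  are the values of its bilinear form at \<open>u\<^sub>i\<close> and \<open>v\<^sub>i\<close>.
\<close>
lemma sum_powr_bilinear_le:
  fixes s :: "nat \<Rightarrow> real" and g h :: "'i \<Rightarrow> nat \<Rightarrow> real" and q :: real
  assumes q: "1 \<le> q" and I: "finite I" "card I \<le> r"
    and dec: "\<And>j k. j \<le> k \<Longrightarrow> k < N \<Longrightarrow> s k \<le> s j" and s: "\<And>k. k < N \<Longrightarrow> 0 \<le> s k"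
    and rows: "\<And>i. i \<in> I \<Longrightarrow> (\<Sum>k<N. (g i k)\<^sup>2) \<le> 1" "\<And>i. i \<in> I \<Longrightarrow> (\<Sum>k<N. (h i k)\<^sup>2) \<le> 1"
    and cols: "\<And>k. k < N \<Longrightarrow> (\<Sum>i\<in>I. (g i k)\<^sup>2) \<le> 1" "\<And>k. k < N \<Longrightarrow> (\<Sum>i\<in>I. (h i k)\<^sup>2) \<le> 1"
  shows "(\<Sum>i\<in>I. \<bar>\<Sum>k<N. s k * g i k * h i k\<bar> powr q) \<le> (\<Sum>k<min r N. s k powr q)"
proof -
  define w where "w = (\<lambda>i k. ((g i k)\<^sup>2 + (h i k)\<^sup>2) / 2)"
  have w0: "0 \<le> w i k" for i k
    by (simp add: w_def)
  have w_row: "(\<Sum>k<N. w i k) \<le> 1" if "i \<in> I" for i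
    using rows[OF that] by (simp add: w_def sum.distrib flip: sum_divide_distrib)
  have w_col: "(\<Sum>i\<in>I. w i k) \<le> 1" if "k < N" for k
    using cols[OF that] by (simp add: w_def sum.distrib flip: sum_divide_distrib)
  have "(\<Sum>i\<in>I. \<bar>\<Sum>k<N. s k * g i k * h i k\<bar> powr q) \<le> (\<Sum>i\<in>I. (\<Sum>k<N. w i k * s k) powr q)"
    using abs_sum_prod_le_weighted[of N s] s q by (intro sum_mono powr_mono2) (auto simp: w_def)
  also have "\<dots> \<le> (\<Sum>i\<in>I. \<Sum>k<N. w i k * s k powr q)"
    using q w0 s w_row by (intro sum_mono powr_sum_le) auto
  also have "\<dots> = (\<Sum>k<N. (\<Sum>i\<in>I. w i k) * s k powr q)"
    by (subst sum.swap) (simp add: sum_distrib_right)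
  also have "\<dots> \<le> (\<Sum>k<min r N. s k powr q)"
  proof (rule sum_weighted_le_sum_largest)
    have "(\<Sum>k<N. \<Sum>i\<in>I. w i k) = (\<Sum>i\<in>I. \<Sum>k<N. w i k)"
      by (rule sum.swap)
    also have "\<dots> \<le> (\<Sum>i\<in>I. 1)"
      by (intro sum_mono w_row)
    finally show "(\<Sum>k<N. \<Sum>i\<in>I. w i k) \<le> real r"
      using I by simp
  qed (use q dec s w0 w_col in \<open>auto intro!: powr_mono2 sum_nonneg\<close>)
  finally show ?thesis .
qed

text \<open>
  The analogue of the previous lemma for \<open>q = \<infinity>\<close>, which concerns a single pair of vectors.
\<close>
lemma abs_bilinear_le:
  fixes s g h :: "nat \<Rightarrow> real"
  assumes s: "\<And>k. k < N \<Longrightarrow> 0 \<le> s k" and b: "\<And>k. k < N \<Longrightarrow> s k \<le> b" and "0 \<le> b"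
    and "(\<Sum>k<N. (g k)\<^sup>2) \<le> 1" "(\<Sum>k<N. (h k)\<^sup>2) \<le> 1"
  shows "\<bar>\<Sum>k<N. s k * g k * h k\<bar> \<le> b"
proof -
  have "\<bar>\<Sum>k<N. s k * g k * h k\<bar> \<le> (\<Sum>k<N. ((g k)\<^sup>2 + (h k)\<^sup>2) / 2 * s k)"
    by (intro abs_sum_prod_le_weighted s)
  also have "\<dots> \<le> (\<Sum>k<N. ((g k)\<^sup>2 + (h k)\<^sup>2) / 2 * b)"
    using b by (intro sum_mono mult_left_mono) auto
  also have "\<dots> = (\<Sum>k<N. ((g k)\<^sup>2 + (h k)\<^sup>2) / 2) * b"
    by (simp add: sum_distrib_right)
  also have "\<dots> \<le> 1 * b"
    using assms by (intro mult_right_mono) (auto simp: sum.distrib simp flip: sum_divide_distrib)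
  finally show ?thesis
    by simp
qed

text \<open>
  A homogeneous linear system with fewer equations than unknowns has a nontrivial solution;
  \<open>I\<close> indexes the unknowns, and one unknown is eliminated per equation.
\<close>
lemma homogeneous_system_nontrivial:
  fixes a :: "nat \<Rightarrow> 'i \<Rightarrow> real"
  assumes "finite I" "r < card I"
  shows "\<exists>c. (\<exists>i\<in>I. c i \<noteq> 0) \<and> (\<forall>k<r. (\<Sum>i\<in>I. a k i * c i) = 0)"
  using assms
proof (induction r arbitrary: a I)
  case 0
  then show ?case
    by (intro exI[of _ "\<lambda>_. 1"]) (auto simp: card_gt_0_iff)
next
  case (Suc r)
  show ?case
  proof (cases "\<exists>p\<in>I. a r p \<noteq> 0")
    case False
    obtain c where "\<exists>i\<in>I. c i \<noteq> 0" "\<forall>k<r. (\<Sum>i\<in>I. a k i * c i) = 0"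
      using Suc.IH[of I a] Suc.prems by auto
    thus ?thesis
      using False by (intro exI[of _ c]) (auto simp: less_Suc_eq)
  next
    case True
    then obtain p where p: "p \<in> I" "a r p \<noteq> 0"
      by auto
    define J where "J = I - {p}"
    define b where "b = (\<lambda>k i. a k i - a k p * a r i / a r p)"
    have J: "finite J" "r < card J" "p \<notin> J" "I = insert p J"
      using p Suc.prems by (auto simp: J_def)
    obtain c where c: "\<exists>i\<in>J. c i \<noteq> 0" "\<forall>k<r. (\<Sum>i\<in>J. b k i * c i) = 0"
      using Suc.IH[of J b] J by auto
    define S where "S = (\<Sum>i\<in>J. a r i * c i)"
    define c' where "c' = c(p := - S / a r p)"
    have c'_sum: "(\<Sum>i\<in>I. a k i * c' i) = (\<Sum>i\<in>J. a k i * c i) - a k p * S / a r p" for k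
    proof -
      have "(\<Sum>i\<in>I. a k i * c' i) = a k p * c' p + (\<Sum>i\<in>J. a k i * c' i)"
        using J by simp
      also have "(\<Sum>i\<in>J. a k i * c' i) = (\<Sum>i\<in>J. a k i * c i)"
        using J by (intro sum.cong) (auto simp: c'_def)
      finally show ?thesis
        by (simp add: c'_def)
    qed
    have "(\<Sum>i\<in>I. a k i * c' i) = 0" if "k < Suc r" for k
    proof (cases "k = r")
      case True
      thus ?thesis
        using p by (simp add: c'_sum S_def)
    next
      case False
      hence "0 = (\<Sum>i\<in>J. b k i * c i)"
        using c that by simp
      also have "\<dots> = (\<Sum>i\<in>J. a k i * c i) - a k p * S / a r p"
        by (simp add: b_def S_def algebra_simps sum_subtractf sum_distrib_left sum_divide_distrib)
      finally show ?thesis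
        by (simp add: c'_sum)
    qed
    moreover have "\<exists>i\<in>I. c' i \<noteq> 0"
      using c J by (auto simp: c'_def)
    ultimately show ?thesis
      by blast
  qed
qed

section \<open>The spectral theorem for real symmetric matrices\<close>

lemma scalar_prod_self_nonneg: "0 \<le> (v :: real vec) \<bullet> v"
  by (auto simp: scalar_prod_def intro!: sum_nonneg)

lemma symmetric_mat_bilinear_commute:
  fixes A :: "real mat"
  assumes "A \<in> carrier_mat n n" "A\<^sup>T = A" "x \<in> carrier_vec n" "y \<in> carrier_vec n"
  shows "x \<bullet> (A *\<^sub>v y) = y \<bullet> (A *\<^sub>v x)"
proof -
  have "x \<bullet> (A *\<^sub>v y) = (A *\<^sub>v y) \<bullet> x"
    using assms by (intro comm_scalar_prod[of _ n]) auto
  also have "\<dots> = y \<bullet> (A *\<^sub>v x)"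
    using transpose_vec_mult_scalar[of A n n x y] assms by simp
  finally show ?thesis .
qed

text \<open>
  Over the complex numbers there is an eigenvector \<open>x = y + \<i> * z\<close> with eigenvalue \<open>l\<close>. Comparing
  \<open>z \<bullet> (A * y)\<close> with \<open>y \<bullet> (A * z)\<close> shows that \<open>l\<close> is real, and then \<open>y\<close> or \<open>z\<close> is a real eigenvector.
\<close>
lemma symmetric_real_eigenvector_exists:
  fixes A :: "real mat"
  assumes A: "A \<in> carrier_mat n n" and sym: "A\<^sup>T = A" and n: "0 < n"
  obtains v e where "v \<in> carrier_vec n" "v \<noteq> 0\<^sub>v n" "A *\<^sub>v v = e \<cdot>\<^sub>v v"
proof -
  let ?A = "map_mat complex_of_real A"
  obtain l where "eigenvalue ?A l"
    using spectrum_non_empty[of ?A n] A n by (auto simp: spectrum_def)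
  then obtain x where x: "x \<in> carrier_vec n" "x \<noteq> 0\<^sub>v n" and Ax: "?A *\<^sub>v x = l \<cdot>\<^sub>v x"
    using A by (auto simp: eigenvalue_def eigenvector_def)
  define y where "y = map_vec Re x"
  define z where "z = map_vec Im x"
  have y: "y \<in> carrier_vec n" and z: "z \<in> carrier_vec n"
    using x by (auto simp: y_def z_def)
  have comp: "(\<Sum>j<n. complex_of_real (A $$ (i, j)) * x $ j) = l * x $ i" if "i < n" for i
    using arg_cong[OF Ax, of "\<lambda>v. v $ i"] that A x
    by (simp add: scalar_prod_def atLeast0LessThan)
  have Ay: "A *\<^sub>v y = Re l \<cdot>\<^sub>v y - Im l \<cdot>\<^sub>v z"
  proof (rule eq_vecI)
    fix i assume "i < dim_vec (Re l \<cdot>\<^sub>v y - Im l \<cdot>\<^sub>v z)"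
    hence i: "i < n"
      using z by simp
    have "(A *\<^sub>v y) $ i = Re (\<Sum>j<n. complex_of_real (A $$ (i, j)) * x $ j)"
      using i A x by (simp add: scalar_prod_def atLeast0LessThan y_def)
    thus "(A *\<^sub>v y) $ i = (Re l \<cdot>\<^sub>v y - Im l \<cdot>\<^sub>v z) $ i"
      unfolding comp[OF i] using i x by (simp add: y_def z_def)
  qed (use A y z in auto)
  have Az: "A *\<^sub>v z = Re l \<cdot>\<^sub>v z + Im l \<cdot>\<^sub>v y"
  proof (rule eq_vecI)
    fix i assume "i < dim_vec (Re l \<cdot>\<^sub>v z + Im l \<cdot>\<^sub>v y)"
    hence i: "i < n"
      using y by simp
    have "(A *\<^sub>v z) $ i = Im (\<Sum>j<n. complex_of_real (A $$ (i, j)) * x $ j)"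
      using i A x by (simp add: scalar_prod_def atLeast0LessThan z_def)
    thus "(A *\<^sub>v z) $ i = (Re l \<cdot>\<^sub>v z + Im l \<cdot>\<^sub>v y) $ i"
      unfolding comp[OF i] using i x by (simp add: y_def z_def)
  qed (use A y z in auto)
  have "z \<bullet> (A *\<^sub>v y) = y \<bullet> (A *\<^sub>v z)"
    using A sym y z by (intro symmetric_mat_bilinear_commute)
  hence "Re l * (z \<bullet> y) - Im l * (z \<bullet> z) = Re l * (y \<bullet> z) + Im l * (y \<bullet> y)"
    using y z by (simp add: Ay Az scalar_prod_minus_distrib[of _ n] scalar_prod_add_distrib[of _ n])
  hence "Im l * (y \<bullet> y + z \<bullet> z) = 0"
    using comm_scalar_prod[OF y z] by (simp add: algebra_simps)
  moreover have nz: "y \<noteq> 0\<^sub>v n \<or> z \<noteq> 0\<^sub>v n"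
  proof (rule ccontr)
    assume *: "\<not> (y \<noteq> 0\<^sub>v n \<or> z \<noteq> 0\<^sub>v n)"
    have "x $ i = 0" if "i < n" for i
    proof -
      have "y $ i = 0" "z $ i = 0"
        using * that by auto
      thus ?thesis
        using that x by (simp add: y_def z_def complex_eq_iff)
    qed
    hence "x = 0\<^sub>v n"
      using x by (intro eq_vecI) auto
    thus False
      using x by simp
  qed
  moreover have "y \<bullet> y + z \<bullet> z \<noteq> 0"
    using nz conjugate_square_eq_0_vec[OF y] conjugate_square_eq_0_vec[OF z]
      scalar_prod_self_nonneg[of y] scalar_prod_self_nonneg[of z] y z
    by (auto simp: add_nonneg_eq_0_iff)
  ultimately have "Im l = 0"
    by simp
  hence "A *\<^sub>v y = Re l \<cdot>\<^sub>v y" "A *\<^sub>v z = Re l \<cdot>\<^sub>v z"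
    using y z by (auto simp: Ay Az)
  thus ?thesis
    using that y z nz by blast
qed

lemma orthonormal_basis_extension:
  fixes v :: "real vec"
  assumes v: "v \<in> carrier_vec n" "v \<noteq> 0\<^sub>v n"
  obtains W a where "W \<in> carrier_mat n n" "W\<^sup>T * W = 1\<^sub>m n" "col W 0 = a \<cdot>\<^sub>v v"
proof -
  interpret cof_vec_space n "TYPE(real)" .
  define b where "b = basis_completion v"
  define ws where "ws = gram_schmidt n b"
  note b = basis_completion[OF v, folded b_def]
  have n: "0 < n"
    using v by (cases n) auto
  have ws: "set ws \<subseteq> carrier_vec n" "corthogonal ws" "length ws = n"
    using gram_schmidt_result[OF b(2,4,5) ws_def] b(6) by auto
  have hd_ws: "ws ! 0 = v"
    using gram_schmidt_hd[OF v(1), of "tl b"] b(6,7) ws(3) n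
    by (metis hd_conv_nth length_0_conv list.collapse neq0_conv ws_def)
  have wsi: "ws ! i \<in> carrier_vec n" if "i < n" for i
    using ws that by (meson nth_mem subsetD)
  have orth: "ws ! i \<bullet> ws ! j = 0 \<longleftrightarrow> i \<noteq> j" if "i < n" "j < n" for i j
    using corthogonalD[OF ws(2), of i j] that ws(3) by simp
  define W where "W = mat_of_cols n (map (\<lambda>w. (1 / sqrt (w \<bullet> w)) \<cdot>\<^sub>v w) ws)"
  have W: "W \<in> carrier_mat n n"
    using ws(3) by (auto simp: W_def)
  have colW: "col W i = (1 / sqrt (ws ! i \<bullet> ws ! i)) \<cdot>\<^sub>v ws ! i" if "i < n" for i
    using that ws(3) wsi[OF that] by (simp add: W_def)
  have "W\<^sup>T * W = 1\<^sub>m n"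
  proof (rule eq_matI)
    fix i j assume "i < dim_row (1\<^sub>m n :: real mat)" "j < dim_col (1\<^sub>m n :: real mat)"
    hence ij: "i < n" "j < n"
      by auto
    have "ws ! i \<bullet> ws ! i \<ge> 0" using scalar_prod_self_nonneg by blast
    hence "ws ! i \<bullet> ws ! i > 0"
      using orth[of i i] ij by simp
    thus "(W\<^sup>T * W) $$ (i, j) = 1\<^sub>m n $$ (i, j)"
      using W ij wsi orth[of i j]
      by (auto simp: colW smult_scalar_prod_distrib[of _ n] scalar_prod_smult_distrib[of _ n])
  qed (use W in auto)
  thus ?thesis
    using that[of W] W colW[OF n] hd_ws by simp
qed

lemma spectral_theorem_symmetric_real:
  fixes A :: "real mat"
  assumes "A \<in> carrier_mat n n" "A\<^sup>T = A"
  shows "\<exists>V d. V \<in> carrier_mat n n \<and> V\<^sup>T * V = 1\<^sub>m n \<and> A = V * mat_diag n d * V\<^sup>T"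
  using assms
proof (induction n arbitrary: A)
  case 0
  then show ?case
    by (intro exI[of _ "1\<^sub>m 0"] exI[of _ "\<lambda>_. 0"]) auto
next
  case (Suc n)
  note A = Suc.prems
  obtain v e where v: "v \<in> carrier_vec (Suc n)" "v \<noteq> 0\<^sub>v (Suc n)" and Av: "A *\<^sub>v v = e \<cdot>\<^sub>v v"
    using symmetric_real_eigenvector_exists[OF A] by auto
  obtain W a where W: "W \<in> carrier_mat (Suc n) (Suc n)" and WW: "W\<^sup>T * W = 1\<^sub>m (Suc n)"
    and W0: "col W 0 = a \<cdot>\<^sub>v v"
    using orthonormal_basis_extension[OF v] by metis
  have WW': "W * W\<^sup>T = 1\<^sub>m (Suc n)"
    using mat_mult_left_right_inverse[OF _ W WW] W by simp
  \<comment> \<open>In the basis \<open>W\<close>, the matrix \<open>A\<close> splits into the eigenvalue \<open>e\<close> and a symmetric block of size \<open>n\<close>.\<close>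
  define B where "B = W\<^sup>T * (A * W)"
  have B: "B \<in> carrier_mat (Suc n) (Suc n)"
    using W A by (simp add: B_def)
  have B_sym: "B\<^sup>T = B"
    using W A by (simp add: B_def transpose_mult[of _ "Suc n" "Suc n" _ "Suc n"]
        assoc_mult_mat[of _ "Suc n" "Suc n" _ "Suc n" _ "Suc n"])
  have A_eq: "A = W * B * W\<^sup>T"
  proof -
    have "W * B * W\<^sup>T = (W * W\<^sup>T) * A * (W * W\<^sup>T)"
      using W A by (simp add: B_def assoc_mult_mat[of _ "Suc n" "Suc n" _ "Suc n" _ "Suc n"])
    thus ?thesis
      using A by (simp add: WW')
  qed
  have AW0: "A *\<^sub>v col W 0 = e \<cdot>\<^sub>v col W 0"
    using A v Av by (simp add: W0 mult_mat_vec[of _ "Suc n" "Suc n"] smult_smult_assoc mult.commute)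
  have B0: "B $$ (i, 0) = (if i = 0 then e else 0)" if "i < Suc n" for i
  proof -
    have "col (A * W) 0 = A *\<^sub>v col W 0"
      by (rule col_mult2[OF A(1) W]) simp
    moreover have "B $$ (i, 0) = row W\<^sup>T i \<bullet> col (A * W) 0"
      unfolding B_def using W A that by (intro index_mult_mat(1)) auto
    ultimately have "B $$ (i, 0) = col W i \<bullet> (A *\<^sub>v col W 0)"
      using W that by simp
    also have "\<dots> = e * (W\<^sup>T * W) $$ (i, 0)"
      using W that by (simp add: AW0)
    finally show ?thesis
      using that by (simp add: WW)
  qed
  have B0': "B $$ (0, i) = (if i = 0 then e else 0)" if "i < Suc n" for i
    using B0[OF that] B_sym B that by (metis carrier_matD index_transpose_mat(1) zero_less_Suc)
  define C where "C = mat n n (\<lambda>(i, j). B $$ (Suc i, Suc j))"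
  have C: "C \<in> carrier_mat n n"
    by (simp add: C_def)
  have "C\<^sup>T = C"
  proof (rule eq_matI)
    fix i j assume "i < dim_row C" "j < dim_col C"
    thus "C\<^sup>T $$ (i, j) = C $$ (i, j)"
      using arg_cong[OF B_sym, of "\<lambda>X. X $$ (Suc i, Suc j)"] B by (simp add: C_def)
  qed (auto simp: C_def)
  then obtain V d where V: "V \<in> carrier_mat n n" and VV: "V\<^sup>T * V = 1\<^sub>m n"
    and C_eq: "C = V * mat_diag n d * V\<^sup>T"
    using Suc.IH[OF C] by blast
  define E where "E = mat 1 1 (\<lambda>_. e)"
  define F where "F = four_block_mat (1\<^sub>m 1) (0\<^sub>m 1 n) (0\<^sub>m n 1) V"
  define d' where "d' = case_nat e d"
  have E: "E \<in> carrier_mat 1 1"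
    by (simp add: E_def)
  have F: "F \<in> carrier_mat (Suc n) (Suc n)"
    using four_block_carrier_mat[of "1\<^sub>m 1" 1 1 V n n] V by (simp add: F_def)
  have FT: "F\<^sup>T = four_block_mat (1\<^sub>m 1) (0\<^sub>m 1 n) (0\<^sub>m n 1) V\<^sup>T"
    using V by (simp add: F_def transpose_four_block_mat[of _ 1 1 _ n _ n])
  have FF: "F\<^sup>T * F = 1\<^sub>m (Suc n)"
  proof -
    have "F\<^sup>T * F = four_block_mat (1\<^sub>m 1) (0\<^sub>m 1 n) (0\<^sub>m n 1) (1\<^sub>m n)"
      unfolding FT unfolding F_def
      using V by (subst mult_four_block_mat[of _ 1 1 _ n _ n _ _ 1 _ n]) (auto simp: VV)
    also have "\<dots> = 1\<^sub>m (Suc n)"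
      by (rule eq_matI) auto
    finally show ?thesis .
  qed
  have D: "mat_diag (Suc n) d' = four_block_mat E (0\<^sub>m 1 n) (0\<^sub>m n 1) (mat_diag n d)"
    by (rule eq_matI) (auto simp: mat_diag_def d'_def E_def split: nat.splits)
  have "B = four_block_mat E (0\<^sub>m 1 n) (0\<^sub>m n 1) C"
  proof (rule eq_matI)
    fix i j
    assume "i < dim_row (four_block_mat E (0\<^sub>m 1 n) (0\<^sub>m n 1) C)"
      "j < dim_col (four_block_mat E (0\<^sub>m 1 n) (0\<^sub>m n 1) C)"
    hence "i < Suc n" "j < Suc n"
      by (auto simp: E_def C_def)
    thus "B $$ (i, j) = four_block_mat E (0\<^sub>m 1 n) (0\<^sub>m n 1) C $$ (i, j)"
      using B0[of i] B0'[of j] by (auto simp: E_def C_def)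
  qed (use B in \<open>auto simp: E_def C_def\<close>)
  also have "\<dots> = F * mat_diag (Suc n) d' * F\<^sup>T"
  proof -
    have "F * mat_diag (Suc n) d' = four_block_mat E (0\<^sub>m 1 n) (0\<^sub>m n 1) (V * mat_diag n d)"
      unfolding D F_def using V E left_mult_zero_mat[OF mat_diag_dim[of n d], of 1]
      by (subst mult_four_block_mat[of _ 1 1 _ n _ n _ _ 1 _ n]) auto
    moreover have "\<dots> * F\<^sup>T = four_block_mat E (0\<^sub>m 1 n) (0\<^sub>m n 1) C"
    proof -
      have "V * mat_diag n d \<in> carrier_mat n n"
        using V by simp
      thus ?thesis
        unfolding FT C_eq using V E
          right_mult_zero_mat[of "V * mat_diag n d" n n 1] left_add_zero_mat[of "V * mat_diag n d * V\<^sup>T" n n]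
        by (subst mult_four_block_mat[of _ 1 1 _ n _ n _ _ 1 _ n]) auto
    qed
    ultimately show ?thesis
      by simp
  qed
  finally have "A = W * (F * mat_diag (Suc n) d' * F\<^sup>T) * W\<^sup>T"
    using A_eq by simp
  hence "A = (W * F) * mat_diag (Suc n) d' * (W * F)\<^sup>T"
    using W F by (simp add: transpose_mult[of _ "Suc n" "Suc n"]
        assoc_mult_mat[of _ "Suc n" "Suc n" _ "Suc n" _ "Suc n"] mult_carrier_mat[of _ "Suc n" "Suc n"])
  moreover have "(W * F)\<^sup>T * (W * F) = 1\<^sub>m (Suc n)"
  proof -
    have "(W * F)\<^sup>T * (W * F) = F\<^sup>T * ((W\<^sup>T * W) * F)"
      using W F by (simp add: transpose_mult[of _ "Suc n" "Suc n"]
          assoc_mult_mat[of _ "Suc n" "Suc n" _ "Suc n" _ "Suc n"])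
    thus ?thesis
      using F by (simp add: WW FF)
  qed
  ultimately show ?case
    using W F by (intro exI[of _ "W * F"] exI[of _ d']) auto
qed

section \<open>Orthonormal families and singular value decompositions\<close>

text \<open>
  The linear combination \<open>\<Sum>i\<in>I. c i \<cdot>\<^sub>v u i\<close> of vectors of dimension \<open>n\<close>, given by its coordinates.
\<close>
definition vec_comb :: "nat \<Rightarrow> 'i set \<Rightarrow> ('i \<Rightarrow> real) \<Rightarrow> ('i \<Rightarrow> real vec) \<Rightarrow> real vec" where
  "vec_comb n I c u = vec n (\<lambda>a. \<Sum>i\<in>I. c i * u i $ a)"

lemma vec_comb_carrier [simp]: "vec_comb n I c u \<in> carrier_vec n"
  by (simp add: vec_comb_def)

lemma scalar_prod_vec_comb:
  assumes "y \<in> carrier_vec n" "\<And>i. i \<in> I \<Longrightarrow> u i \<in> carrier_vec n"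
  shows "y \<bullet> vec_comb n I c u = (\<Sum>i\<in>I. c i * (y \<bullet> u i))"
proof -
  have "y \<bullet> vec_comb n I c u = (\<Sum>a<n. \<Sum>i\<in>I. c i * (y $ a * u i $ a))"
    by (auto simp: scalar_prod_def vec_comb_def sum_distrib_left atLeast0LessThan mult_ac intro!: sum.cong)
  also have "\<dots> = (\<Sum>i\<in>I. \<Sum>a<n. c i * (y $ a * u i $ a))"
    by (rule sum.swap)
  also have "\<dots> = (\<Sum>i\<in>I. c i * (y \<bullet> u i))"
  proof (rule sum.cong)
    fix i assume "i \<in> I"
    hence "dim_vec (u i) = n"
      using assms by auto
    thus "(\<Sum>a<n. c i * (y $ a * u i $ a)) = c i * (y \<bullet> u i)"
      by (simp add: scalar_prod_def sum_distrib_left atLeast0LessThan)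
  qed simp
  finally show ?thesis .
qed

lemma mult_mat_vec_comb:
  assumes "A \<in> carrier_mat m n" "\<And>i. i \<in> I \<Longrightarrow> u i \<in> carrier_vec n"
  shows "A *\<^sub>v vec_comb n I c u = vec_comb m I c (\<lambda>i. A *\<^sub>v u i)"
proof (rule eq_vecI)
  fix a assume "a < dim_vec (vec_comb m I c (\<lambda>i. A *\<^sub>v u i))"
  hence a: "a < m"
    by (simp add: vec_comb_def)
  have "(A *\<^sub>v vec_comb n I c u) $ a = row A a \<bullet> vec_comb n I c u"
    using a assms by simp
  also have "\<dots> = (\<Sum>i\<in>I. c i * (row A a \<bullet> u i))"
    using assms a by (intro scalar_prod_vec_comb) auto
  finally show "(A *\<^sub>v vec_comb n I c u) $ a = vec_comb m I c (\<lambda>i. A *\<^sub>v u i) $ a"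
    using a assms by (simp add: vec_comb_def)
qed (use assms in \<open>auto simp: vec_comb_def\<close>)

text \<open>
  An indexed family of vectors of dimension \<open>n\<close> that is orthonormal on the index set \<open>I\<close>; values
  outside \<open>I\<close> are irrelevant.
\<close>
definition orthonormal_family :: "nat \<Rightarrow> 'i set \<Rightarrow> ('i \<Rightarrow> real vec) \<Rightarrow> bool" where
  "orthonormal_family n I u \<longleftrightarrow> (\<forall>i\<in>I. u i \<in> carrier_vec n) \<and>
     (\<forall>i\<in>I. \<forall>j\<in>I. u i \<bullet> u j = (if i = j then 1 else 0))"

lemma orthonormal_familyD:
  assumes "orthonormal_family n I u" "i \<in> I"
  shows "u i \<in> carrier_vec n" "u i \<bullet> u i = 1" "j \<in> I \<Longrightarrow> u i \<bullet> u j = (if i = j then 1 else 0)"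
  using assms by (auto simp: orthonormal_family_def)

lemma orthonormal_family_mono:
  "orthonormal_family n I u \<Longrightarrow> J \<subseteq> I \<Longrightarrow> orthonormal_family n J u"
  unfolding orthonormal_family_def by blast

lemma orthonormal_cols_family:
  assumes "W \<in> carrier_mat m n" "orthonormal_cols W"
  shows "orthonormal_family m {..<n} (col W)"
proof -
  have "col W i \<bullet> col W j = (if i = j then 1 else 0)" if "i < n" "j < n" for i j
    using arg_cong[OF assms(2)[unfolded orthonormal_cols_def], of "\<lambda>X. X $$ (i, j)"] assms(1) that
    by simp
  thus ?thesis
    using assms(1) by (auto simp: orthonormal_family_def)
qed

lemma scalar_prod_orthonormal_comb:
  assumes "orthonormal_family n I u" "finite I" "i \<in> I"
  shows "u i \<bullet> vec_comb n I c u = c i"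
proof -
  have "u i \<bullet> vec_comb n I c u = (\<Sum>j\<in>I. c j * (u i \<bullet> u j))"
    using assms by (intro scalar_prod_vec_comb) (auto simp: orthonormal_family_def)
  also have "\<dots> = (\<Sum>j\<in>I. if i = j then c j else 0)"
    using assms by (intro sum.cong) (auto simp: orthonormal_family_def)
  finally show ?thesis
    using assms by simp
qed

lemma norm_orthonormal_comb:
  assumes "orthonormal_family n I u" "finite I"
  shows "vec_comb n I c u \<bullet> vec_comb n I c u = (\<Sum>i\<in>I. (c i)\<^sup>2)"
proof -
  let ?p = "vec_comb n I c u"
  have "?p \<bullet> ?p = (\<Sum>i\<in>I. c i * (?p \<bullet> u i))"
    using assms by (intro scalar_prod_vec_comb) (auto simp: orthonormal_family_def)
  also have "\<dots> = (\<Sum>i\<in>I. (c i)\<^sup>2)"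
    using assms scalar_prod_orthonormal_comb[OF assms]
    by (intro sum.cong) (auto simp: orthonormal_family_def power2_eq_square comm_scalar_prod[of ?p n])
  finally show ?thesis .
qed

lemma bessel_inequality:
  assumes u: "orthonormal_family n I u" "finite I" and a: "a \<in> carrier_vec n"
  shows "(\<Sum>i\<in>I. (u i \<bullet> a)\<^sup>2) \<le> a \<bullet> a"
proof -
  define p where "p = vec_comb n I (\<lambda>i. u i \<bullet> a) u"
  have p: "p \<in> carrier_vec n"
    by (simp add: p_def)
  have "a \<bullet> p = (\<Sum>i\<in>I. (u i \<bullet> a) * (a \<bullet> u i))"
    unfolding p_def using u a by (intro scalar_prod_vec_comb) (auto simp: orthonormal_family_def)
  also have "\<dots> = (\<Sum>i\<in>I. (u i \<bullet> a)\<^sup>2)"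
    using u a by (intro sum.cong) (auto simp: orthonormal_family_def power2_eq_square comm_scalar_prod[of a n])
  finally have ap: "a \<bullet> p = (\<Sum>i\<in>I. (u i \<bullet> a)\<^sup>2)" .
  \<comment> \<open>\<open>p\<close> is the orthogonal projection of \<open>a\<close> onto the span of the family.\<close>
  have "0 \<le> (a - p) \<bullet> (a - p)"
    by (rule scalar_prod_self_nonneg)
  also have "\<dots> = a \<bullet> a - 2 * (a \<bullet> p) + p \<bullet> p"
    using a p comm_scalar_prod[OF a p]
    by (simp add: scalar_prod_minus_distrib[of _ n] minus_scalar_prod_distrib[of _ n])
  also have "p \<bullet> p = a \<bullet> p"
    using norm_orthonormal_comb[OF u, of "\<lambda>i. u i \<bullet> a"] ap by (simp add: p_def)
  finally show ?thesis
    by (simp add: ap)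
qed

lemma parseval_identity:
  assumes W: "W \<in> carrier_mat n n" "orthonormal_cols W" and x: "x \<in> carrier_vec n"
  shows "(\<Sum>k<n. (col W k \<bullet> x)\<^sup>2) = x \<bullet> x"
proof -
  have WW': "W * W\<^sup>T = 1\<^sub>m n"
    using mat_mult_left_right_inverse[of "W\<^sup>T" n W] W by (simp add: orthonormal_cols_def)
  have "(\<Sum>k<n. (col W k \<bullet> x)\<^sup>2) = (W\<^sup>T *\<^sub>v x) \<bullet> (W\<^sup>T *\<^sub>v x)"
    using W by (simp add: scalar_prod_def[of "W\<^sup>T *\<^sub>v x"] power2_eq_square atLeast0LessThan)
  also have "\<dots> = x \<bullet> (W *\<^sub>v (W\<^sup>T *\<^sub>v x))"
    using transpose_vec_mult_scalar[of W n n "W\<^sup>T *\<^sub>v x" x] W x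
    by simp
  also have "W *\<^sub>v (W\<^sup>T *\<^sub>v x) = x"
    using W x WW' assoc_mult_mat_vec[of W n n "W\<^sup>T" n x] by simp
  finally show ?thesis .
qed

lemma rect_diag_conjugate_entry:
  assumes U: "U \<in> carrier_mat m m" and V: "V \<in> carrier_mat n n" and ab: "a < m" "b < n"
  shows "(U * rect_diag m n s * V\<^sup>T) $$ (a, b) = (\<Sum>k<min m n. s ! k * U $$ (a, k) * V $$ (b, k))"
proof -
  have UD: "(U * rect_diag m n s) $$ (a, j) = (if j < m then U $$ (a, j) * s ! j else 0)" if "j < n" for j
  proof -
    have "(U * rect_diag m n s) $$ (a, j) = (\<Sum>k<m. if k = j then U $$ (a, j) * s ! j else 0)"
      using U ab that
      by (simp add: rect_diag_def scalar_prod_def atLeast0LessThan if_distrib[of "(*) _"] cong: if_cong)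
    thus ?thesis
      by simp
  qed
  have "(U * rect_diag m n s * V\<^sup>T) $$ (a, b) = (\<Sum>j<n. (U * rect_diag m n s) $$ (a, j) * V $$ (b, j))"
    using U V ab by (simp add: rect_diag_def scalar_prod_def[of "row _ _"] atLeast0LessThan)
  also have "\<dots> = (\<Sum>j<n. if j < m then s ! j * U $$ (a, j) * V $$ (b, j) else 0)"
    using UD by (intro sum.cong) auto
  also have "\<dots> = (\<Sum>k<min m n. s ! k * U $$ (a, k) * V $$ (b, k))"
    by (intro sum.mono_neutral_cong_right) auto
  finally show ?thesis .
qed

lemma svd_bilinear:
  assumes svd: "is_svd M U s V" and M: "M \<in> carrier_mat m n"
    and y: "y \<in> carrier_vec m" and x: "x \<in> carrier_vec n"
  shows "y \<bullet> (M *\<^sub>v x) = (\<Sum>k<min m n. s ! k * (col U k \<bullet> y) * (col V k \<bullet> x))"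
proof -
  have U: "U \<in> carrier_mat m m" and V: "V \<in> carrier_mat n n" and M_eq: "M = U * rect_diag m n s * V\<^sup>T"
    using svd M by (auto simp: is_svd_def)
  have "y \<bullet> (M *\<^sub>v x) = (\<Sum>a<m. \<Sum>b<n. y $ a * M $$ (a, b) * x $ b)"
    using M x by (simp add: scalar_prod_def atLeast0LessThan sum_distrib_left mult_ac)
  also have "\<dots> = (\<Sum>a<m. \<Sum>b<n. \<Sum>k<min m n. s ! k * (U $$ (a, k) * y $ a) * (V $$ (b, k) * x $ b))"
    unfolding M_eq using rect_diag_conjugate_entry[OF U V]
    by (intro sum.cong) (auto simp: sum_distrib_left sum_distrib_right mult_ac intro!: sum.cong)
  also have "\<dots> = (\<Sum>a<m. \<Sum>k<min m n. \<Sum>b<n. s ! k * (U $$ (a, k) * y $ a) * (V $$ (b, k) * x $ b))"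
    by (intro sum.cong sum.swap refl)
  also have "\<dots> = (\<Sum>k<min m n. \<Sum>a<m. \<Sum>b<n. s ! k * (U $$ (a, k) * y $ a) * (V $$ (b, k) * x $ b))"
    by (rule sum.swap)
  also have "\<dots> = (\<Sum>k<min m n. s ! k * (\<Sum>a<m. U $$ (a, k) * y $ a) * (\<Sum>b<n. V $$ (b, k) * x $ b))"
    by (simp add: sum_distrib_left sum_distrib_right mult_ac)
  also have "\<dots> = (\<Sum>k<min m n. s ! k * (col U k \<bullet> y) * (col V k \<bullet> x))"
    using U V x y by (intro sum.cong) (auto simp: scalar_prod_def atLeast0LessThan)
  finally show ?thesis .
qed

lemma svd_norm_mult_vec:
  assumes svd: "is_svd M U s V" and M: "M \<in> carrier_mat m n" and x: "x \<in> carrier_vec n"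
  shows "(M *\<^sub>v x) \<bullet> (M *\<^sub>v x) = (\<Sum>k<min m n. (s ! k)\<^sup>2 * (col V k \<bullet> x)\<^sup>2)"
proof -
  have U: "U \<in> carrier_mat m m" "orthonormal_cols U"
    using svd M by (auto simp: is_svd_def)
  note onf = orthonormal_cols_family[OF U]
  have Mx: "M *\<^sub>v x \<in> carrier_vec m"
    using M x by simp
  have coord: "col U k \<bullet> (M *\<^sub>v x) = (if k < n then s ! k * (col V k \<bullet> x) else 0)" if "k < m" for k
  proof -
    have "col U k \<bullet> (M *\<^sub>v x) = (\<Sum>j<min m n. s ! j * (col U j \<bullet> col U k) * (col V j \<bullet> x))"
      using U that by (intro svd_bilinear[OF svd M _ x]) auto
    also have "\<dots> = (\<Sum>j<min m n. if j = k then s ! k * (col V k \<bullet> x) else 0)"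
      using onf that by (intro sum.cong) (auto simp: orthonormal_family_def)
    finally show ?thesis
      using that by simp
  qed
  have "(M *\<^sub>v x) \<bullet> (M *\<^sub>v x) = (\<Sum>k<m. (col U k \<bullet> (M *\<^sub>v x))\<^sup>2)"
    by (rule parseval_identity[OF U Mx, symmetric])
  also have "\<dots> = (\<Sum>k<m. if k < n then (s ! k)\<^sup>2 * (col V k \<bullet> x)\<^sup>2 else 0)"
    using coord by (intro sum.cong) (auto simp: power_mult_distrib)
  also have "\<dots> = (\<Sum>k<min m n. (s ! k)\<^sup>2 * (col V k \<bullet> x)\<^sup>2)"
    by (intro sum.mono_neutral_cong_right) auto
  finally show ?thesis .
qed

lemma svd_values:
  assumes svd: "is_svd M U s V" and M: "M \<in> carrier_mat m n"
  shows "j \<le> k \<Longrightarrow> k < min m n \<Longrightarrow> s ! k \<le> s ! j" and "k < min m n \<Longrightarrow> 0 \<le> s ! k"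
proof -
  have len: "length s = min m n" and sorted: "sorted_wrt (\<ge>) s" and nonneg: "\<forall>x\<in>set s. 0 \<le> x"
    using svd M by (auto simp: is_svd_def)
  show "s ! k \<le> s ! j" if "j \<le> k" "k < min m n"
    using sorted_wrt_nth_less[OF sorted, of j k] that len by (cases "j = k") auto
  show "0 \<le> s ! k" if "k < min m n"
    using nonneg len that by (metis nth_mem)
qed

text \<open>
  Truncation keeps the singular vectors and replaces all but the first \<open>r\<close> singular values by zero.
\<close>
lemma singular_values_svd_trunc:
  assumes svd: "is_svd M U s V" and M: "M \<in> carrier_mat m n" and r: "r \<le> min m n"
  shows "singular_values (svd_trunc r U s V) = take r s @ replicate (min m n - r) 0"
proof -
  let ?s = "take r s @ replicate (min m n - r) 0"
  have U: "U \<in> carrier_mat m m" "orthonormal_cols U" and V: "V \<in> carrier_mat n n" "orthonormal_cols V"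
    and len: "length s = min m n" and sorted: "sorted_wrt (\<ge>) s" and nonneg: "\<forall>x\<in>set s. 0 \<le> x"
    using svd M by (auto simp: is_svd_def)
  have T: "svd_trunc r U s V \<in> carrier_mat m n"
    using U V by (simp add: svd_trunc_def)
  have "svd_trunc r U s V = U * rect_diag m n ?s * V\<^sup>T"
  proof (rule eq_matI)
    fix a b assume "a < dim_row (U * rect_diag m n ?s * V\<^sup>T)" "b < dim_col (U * rect_diag m n ?s * V\<^sup>T)"
    hence ab: "a < m" "b < n"
      using U V by auto
    have "(U * rect_diag m n ?s * V\<^sup>T) $$ (a, b) = (\<Sum>k<min m n. ?s ! k * U $$ (a, k) * V $$ (b, k))"
      by (rule rect_diag_conjugate_entry[OF U(1) V(1) ab])
    also have "\<dots> = (\<Sum>k<r. s ! k * U $$ (a, k) * V $$ (b, k))"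
      using r len by (intro sum.mono_neutral_cong_right) (auto simp: nth_append)
    also have "\<dots> = svd_trunc r U s V $$ (a, b)"
      using U V ab r by (auto simp: svd_trunc_def intro!: sum.cong)
    finally show "svd_trunc r U s V $$ (a, b) = (U * rect_diag m n ?s * V\<^sup>T) $$ (a, b)"
      by simp
  qed (use U V T in \<open>auto simp: svd_trunc_def\<close>)
  hence "is_svd (svd_trunc r U s V) U ?s V"
    using U V T r len sorted nonneg
    by (auto simp: is_svd_def sorted_wrt_append sorted_wrt_take sorted_wrt_iff_nth_less[of _ "replicate _ _"]
        dest: in_set_takeD)
  thus ?thesis
    by (rule singular_values_eq)
qed

text \<open>
  The columns of \<open>C\<close> are a maximal linearly independent set of columns of \<open>A\<close>, and \<open>D\<close> contains the
  coefficients that express all columns by them.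
\<close>
lemma rank_factorization:
  fixes A :: "real mat"
  assumes A: "A \<in> carrier_mat m n" and rank: "vec_space.rank m A = r"
  obtains C D where "C \<in> carrier_mat m r" "D \<in> carrier_mat r n" "A = C * D"
proof -
  interpret vec_space "TYPE(real)" m .
  have cols: "set (cols A) \<subseteq> carrier_vec m"
    using cols_dim A by blast
  obtain S where S: "maximal S (\<lambda>T. T \<subseteq> set (cols A) \<and> lin_indpt T)"
    using maximal_exists_superset[of "set (cols A)" "\<lambda>T. T \<subseteq> set (cols A) \<and> lin_indpt T" "{}"]
      finite_lin_indpt2[of "{}"] by auto
  have S': "S \<subseteq> set (cols A)" "lin_indpt S" "S \<subseteq> carrier_vec m" "finite S"
    using S cols finite_subset[of S "set (cols A)"] by (auto simp: maximal_def)
  have "card S = r"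
    using rank_card_indpt[OF A S] rank by simp
  then obtain ss where ss: "set ss = S" "distinct ss" "length ss = r"
    using finite_distinct_list[OF S'(4)] distinct_card by metis
  have "\<exists>f. col A b = lincomb f S" if "b < n" for b
  proof -
    have b: "col A b \<in> set (cols A)" "col A b \<in> carrier_vec m"
      using A that by (auto simp: cols_def)
    have "col A b \<in> span S"
    proof (rule ccontr)
      assume nin: "col A b \<notin> span S"
      hence "lin_indpt (S \<union> {col A b})"
        using lin_dep_iff_in_span[of S "col A b"] S' b span_mem[of S "col A b"] by auto
      hence "S \<union> {col A b} = S"
        using S S' b unfolding maximal_def by (metis Un_upper1 insert_subset sup_bot.right_neutral Un_insert_right)
      thus False
        using nin span_mem[OF S'(3)] by blast
    qed
    thus ?thesis
      using finite_in_span[OF S'(4,3), of "col A b"] by metis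
  qed
  then obtain f where f: "\<And>b. b < n \<Longrightarrow> col A b = lincomb (f b) S"
    by metis
  define C where "C = mat_of_cols m ss"
  define D where "D = mat r n (\<lambda>(k, b). f b (ss ! k))"
  have C: "C \<in> carrier_mat m r" and D: "D \<in> carrier_mat r n"
    using ss by (auto simp: C_def D_def)
  have "A = C * D"
  proof (rule eq_matI)
    fix a b assume "a < dim_row (C * D)" "b < dim_col (C * D)"
    hence ab: "a < m" "b < n"
      using C D by auto
    have "A $$ (a, b) = lincomb (f b) S $ a"
      using ab A f[of b] by (metis carrier_matD index_col)
    also have "\<dots> = (\<Sum>x\<in>S. f b x * x $ a)"
      by (rule lincomb_index[OF ab(1) S'(3)])
    also have "\<dots> = (\<Sum>k<r. f b (ss ! k) * ss ! k $ a)"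
      using ss by (intro sum.reindex_bij_betw[symmetric] bij_betw_nth) auto
    also have "\<dots> = (C * D) $$ (a, b)"
      using C D ab ss by (simp add: scalar_prod_def atLeast0LessThan mult_ac)
        (simp add: C_def D_def mat_of_cols_def mult_ac)
    finally show "A $$ (a, b) = (C * D) $$ (a, b)" .
  qed (use A C D in auto)
  thus ?thesis
    using that C D by blast
qed

section \<open>Singular vectors\<close>

lemma proots_prod_linear_factors: "proots (\<Prod>a\<leftarrow>xs. [:- a, 1:]) = mset (xs :: real list)"
proof (induction xs)
  case (Cons x xs)
  define p where "p = (\<Prod>a\<leftarrow>xs. [:- a, 1:])"
  have "p \<noteq> 0"
    by (auto simp: p_def prod_list_zero_iff)
  hence "proots ([:- x, 1:] * p) = proots [:- x, 1:] + proots p"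
    by (intro proots_mult) auto
  thus ?case
    using Cons by (simp add: p_def del: mult_pCons_left)
qed simp

lemma proots_char_poly_similar_diag:
  fixes A :: "real mat"
  assumes "similar_mat A (mat_diag n d)"
  shows "proots (char_poly A) = image_mset d (mset_set {..<n})"
proof -
  have "char_poly A = char_poly (mat_diag n d)"
    using assms by (rule char_poly_similar)
  also have "\<dots> = (\<Prod>a\<leftarrow>diag_mat (mat_diag n d). [:- a, 1:])"
    by (rule char_poly_upper_triangular[of _ n]) (auto simp: mat_diag_def)
  also have "diag_mat (mat_diag n d) = map d [0..<n]"
    by (auto simp: diag_mat_def mat_diag_def)
  finally have "proots (char_poly A) = proots (\<Prod>a\<leftarrow>map d [0..<n]. [:- a, 1:])"
    by simp
  also have "\<dots> = mset (map d [0..<n])"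
    by (rule proots_prod_linear_factors)
  finally show ?thesis
    by (simp add: atLeast0LessThan)
qed

text \<open>
  The positive singular values with left and right singular vectors. The list \<open>singular_values M\<close>
  and the family \<open>\<sigma>\<close> agree up to order and zeros. Of this, only an inclusion of values and an inequality
  of power sums are stated; they survive dropping entries, so that it does not matter that
  \<open>M\<^sup>T * M\<close> may have more than \<open>min m n\<close> eigenvalues.
\<close>
lemma singular_system_exists:
  assumes M: "M \<in> carrier_mat m n"
  obtains I :: "nat set" and u v :: "nat \<Rightarrow> real vec" and \<sigma> :: "nat \<Rightarrow> real"
  where "finite I" "orthonormal_family m I u" "orthonormal_family n I v"
    "\<And>i. i \<in> I \<Longrightarrow> 0 < \<sigma> i" "\<And>i. i \<in> I \<Longrightarrow> M *\<^sub>v v i = \<sigma> i \<cdot>\<^sub>v u i"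
    "\<And>i. i \<in> I \<Longrightarrow> M\<^sup>T *\<^sub>v u i = \<sigma> i \<cdot>\<^sub>v v i"
    "length (singular_values M) = min m n" "set (singular_values M) \<subseteq> insert 0 (\<sigma> ` I)"
    "\<And>q. (\<Sum>x\<leftarrow>singular_values M. x powr q) \<le> (\<Sum>i\<in>I. \<sigma> i powr q)"
proof -
  define G where "G = M\<^sup>T * M"
  have G: "G \<in> carrier_mat n n" "G\<^sup>T = G"
    using M by (auto simp: G_def transpose_mult[of _ n m _ n])
  obtain V d where V: "V \<in> carrier_mat n n" and VV: "V\<^sup>T * V = 1\<^sub>m n"
    and G_eq: "G = V * mat_diag n d * V\<^sup>T"
    using spectral_theorem_symmetric_real[OF G] by blast
  have VV': "V * V\<^sup>T = 1\<^sub>m n"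
    using mat_mult_left_right_inverse[OF _ V VV] V by simp
  define v where "v = col V"
  define \<sigma> where "\<sigma> = (\<lambda>i. sqrt (d i))"
  define I where "I = {i. i < n \<and> 0 < d i}"
  define u where "u = (\<lambda>i. (1 / \<sigma> i) \<cdot>\<^sub>v (M *\<^sub>v v i))"
  have v_all: "orthonormal_family n {..<n} v"
    unfolding v_def using V VV by (intro orthonormal_cols_family) (auto simp: orthonormal_cols_def)
  have vc: "v i \<in> carrier_vec n" if "i < n" for i
    using V that by (simp add: v_def)
  have Gv: "G *\<^sub>v v i = d i \<cdot>\<^sub>v v i" if "i < n" for i
  proof -
    have "G * V = V * mat_diag n d * (V\<^sup>T * V)"
      unfolding G_eq using V by (simp add: assoc_mult_mat[of _ n n _ n _ n] mult_carrier_mat[of _ n n])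
    hence "G * V = V * mat_diag n d"
      using V by (simp add: VV right_mult_one_mat[of _ n n])
    hence "col (G * V) i = col (V * mat_diag n d) i"
      by simp
    moreover have "col (G * V) i = G *\<^sub>v v i"
      unfolding v_def using G V that by (intro col_mult2[of _ n n _ n]) auto
    moreover have "col (V * mat_diag n d) i = d i \<cdot>\<^sub>v v i"
      unfolding mat_diag_mult_right[OF V] using V that by (auto simp: v_def)
    ultimately show ?thesis
      by simp
  qed
  have MM: "M\<^sup>T *\<^sub>v (M *\<^sub>v v i) = d i \<cdot>\<^sub>v v i" if "i < n" for i
    using Gv[OF that] M vc[OF that] by (simp add: G_def assoc_mult_mat_vec[of _ n m _ n])
  have MvMv: "(M *\<^sub>v v i) \<bullet> (M *\<^sub>v v j) = (if i = j then d i else 0)" if "i < n" "j < n" for i j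
  proof -
    have "(M *\<^sub>v v i) \<bullet> (M *\<^sub>v v j) = (M\<^sup>T *\<^sub>v (M *\<^sub>v v i)) \<bullet> v j"
      using transpose_vec_mult_scalar[of M m n "v j" "M *\<^sub>v v i"] M vc that by simp
    also have "\<dots> = d i * (v i \<bullet> v j)"
      using vc that by (simp add: MM smult_scalar_prod_distrib[of _ n])
    finally show ?thesis
      using v_all that by (simp add: orthonormal_family_def)
  qed
  have d0: "0 \<le> d i" if "i < n" for i
    using MvMv[OF that that] scalar_prod_self_nonneg[of "M *\<^sub>v v i"] by simp
  have \<sigma>I: "0 < \<sigma> i" "\<sigma> i * \<sigma> i = d i" "i < n" if "i \<in> I" for i
    using that by (auto simp: I_def \<sigma>_def)
  have I: "finite I"
    by (simp add: I_def)
  have u: "orthonormal_family m I u"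
  proof -
    have "u i \<bullet> u j = (if i = j then 1 else 0)" if "i \<in> I" "j \<in> I" for i j
    proof -
      have "u i \<bullet> u j = (M *\<^sub>v v i) \<bullet> (M *\<^sub>v v j) / (\<sigma> i * \<sigma> j)"
        using M by (simp add: u_def)
      thus ?thesis
        using \<sigma>I[OF that(1)] \<sigma>I[OF that(2)] by (auto simp: MvMv)
    qed
    moreover have "u i \<in> carrier_vec m" if "i \<in> I" for i
      using M vc[OF \<sigma>I(3)[OF that]] by (simp add: u_def)
    ultimately show ?thesis
      by (simp add: orthonormal_family_def)
  qed
  have v: "orthonormal_family n I v"
    by (rule orthonormal_family_mono[OF v_all]) (auto simp: I_def)
  have Mv: "M *\<^sub>v v i = \<sigma> i \<cdot>\<^sub>v u i" if "i \<in> I" for i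
    using \<sigma>I[OF that] by (simp add: u_def smult_smult_assoc)
  have Mu: "M\<^sup>T *\<^sub>v u i = \<sigma> i \<cdot>\<^sub>v v i" if "i \<in> I" for i
  proof -
    have "M\<^sup>T *\<^sub>v u i = (1 / \<sigma> i) \<cdot>\<^sub>v (M\<^sup>T *\<^sub>v (M *\<^sub>v v i))"
      unfolding u_def using M vc[OF \<sigma>I(3)[OF that]] by (intro mult_mat_vec[of _ n m]) auto
    also have "\<dots> = \<sigma> i \<cdot>\<^sub>v v i"
      using \<sigma>I[OF that] by (simp add: MM smult_smult_assoc flip: \<sigma>I(2)[OF that])
    finally show ?thesis .
  qed
  define X where "X = image_mset \<sigma> (mset_set {..<n})"
  define xs where "xs = rev (sorted_list_of_multiset X)"
  have "similar_mat G (mat_diag n d)"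
    unfolding similar_mat_def similar_mat_wit_def Let_def
    using V VV VV' G G_eq by (intro exI[of _ V] exI[of _ "V\<^sup>T"]) auto
  hence "image_mset sqrt (proots (char_poly G)) = X"
    by (simp add: proots_char_poly_similar_diag X_def \<sigma>_def multiset.map_comp o_def)
  hence sv: "singular_values M = take (min m n) xs"
    using M by (simp add: singular_values_def xs_def G_def)
  have mset_xs: "mset xs = X"
    by (simp add: xs_def)
  have set_xs: "set xs = \<sigma> ` {..<n}"
    using arg_cong[OF mset_xs, of set_mset] by (simp add: X_def)
  have "length xs = n"
    using arg_cong[OF mset_xs, of size] by (simp add: X_def)
  hence len: "length (singular_values M) = min m n"
    by (simp add: sv)
  have \<sigma>_out: "\<sigma> i = 0" if "i < n" "i \<notin> I" for i
    using d0[OF that(1)] that by (simp add: I_def \<sigma>_def)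
  have "set (singular_values M) \<subseteq> insert 0 (\<sigma> ` I)"
    using set_take_subset[of "min m n" xs] \<sigma>_out unfolding sv set_xs by auto
  moreover have "(\<Sum>x\<leftarrow>singular_values M. x powr q) \<le> (\<Sum>i\<in>I. \<sigma> i powr q)" for q
  proof -
    have "(\<Sum>x\<leftarrow>singular_values M. x powr q) \<le> (\<Sum>x\<leftarrow>take (min m n) xs. x powr q) + (\<Sum>x\<leftarrow>drop (min m n) xs. x powr q)"
      unfolding sv by (auto intro!: sum_list_nonneg)
    also have "\<dots> = (\<Sum>x\<leftarrow>xs. x powr q)"
      by (simp flip: sum_list_append map_append)
    also have "\<dots> = (\<Sum>x\<in>#X. x powr q)"
      by (simp flip: mset_xs sum_mset_sum_list)
    also have "\<dots> = (\<Sum>i<n. \<sigma> i powr q)"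
      by (simp add: X_def multiset.map_comp o_def sum_unfold_sum_mset)
    also have "\<dots> = (\<Sum>i\<in>I. \<sigma> i powr q)"
      using \<sigma>_out by (intro sum.mono_neutral_right) (auto simp: I_def)
    finally show ?thesis .
  qed
  ultimately show ?thesis
    using that[OF I u v \<sigma>I(1) Mv Mu len] by simp
qed

section \<open>Perturbation by a matrix of low rank\<close>

text \<open>
  Weyl's inequality for \<open>B = A + Z\<close> with \<open>A = C * D\<close> of rank at most \<open>r\<close>. Some nonzero \<open>x\<close> in the span of
  the first \<open>r + k + 1\<close> right singular vectors of \<open>B\<close> satisfies the \<open>r + k\<close> linear conditions
  \<open>D * x = 0\<close> and \<open>x \<bottom> v\<^sub>l\<close> for the first \<open>k\<close> right singular vectors \<open>v\<^sub>l\<close> of \<open>Z\<close>. Then \<open>B * x = Z * x\<close>,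
  and the two decompositions bound the length of this vector from below and from above. Indices
  start at zero, so \<open>s ! (r + k)\<close> is the singular value number \<open>r + k + 1\<close>.
\<close>
lemma singular_value_low_rank_perturbation:
  assumes C: "C \<in> carrier_mat m r" and D: "D \<in> carrier_mat r n" and Z: "Z \<in> carrier_mat m n"
    and B: "B = C * D + Z" and svdB: "is_svd B U s V" and svdZ: "is_svd Z U' s' V'"
    and k: "r + k < min m n"
  shows "s ! (r + k) \<le> s' ! k"
proof -
  have A: "C * D \<in> carrier_mat m n" and Bc: "B \<in> carrier_mat m n"
    using C D Z B by auto
  have V: "V \<in> carrier_mat n n" "orthonormal_cols V" and V': "V' \<in> carrier_mat n n" "orthonormal_cols V'"
    using svdB svdZ Bc Z by (auto simp: is_svd_def)
  note sB = svd_values[OF svdB Bc] and sZ = svd_values[OF svdZ Z]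
  define J where "J = {..r + k}"
  have J: "finite J" "card J = Suc (r + k)" "J \<subseteq> {..<n}"
    using k by (auto simp: J_def)
  have v: "orthonormal_family n J (col V)"
    using orthonormal_cols_family[OF V] J(3) by (rule orthonormal_family_mono)
  have vc: "col V j \<in> carrier_vec n" if "j \<in> J" for j
    using V by auto
  \<comment> \<open>The first \<open>r\<close> equations express \<open>D * x = 0\<close>, the other \<open>k\<close> express orthogonality to the
    leading right singular vectors of \<open>Z\<close>.\<close>
  define a where "a = (\<lambda>l j. (if l < r then row D l else col V' (l - r)) \<bullet> col V j)"
  obtain c where c: "\<exists>j\<in>J. c j \<noteq> 0" "\<forall>l<r + k. (\<Sum>j\<in>J. a l j * c j) = 0"
    using homogeneous_system_nontrivial[of J "r + k" a] J by auto
  define x where "x = vec_comb n J c (col V)"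
  have x: "x \<in> carrier_vec n"
    by (simp add: x_def)
  have a0: "(if l < r then row D l else col V' (l - r)) \<bullet> x = 0" if "l < r + k" for l
  proof -
    have "(if l < r then row D l else col V' (l - r)) \<bullet> x = (\<Sum>j\<in>J. c j * a l j)"
      unfolding x_def a_def using D V' vc by (intro scalar_prod_vec_comb) auto
    thus ?thesis
      using c(2) that by (simp add: mult.commute)
  qed
  have "D *\<^sub>v x = 0\<^sub>v r"
  proof (rule eq_vecI)
    fix l assume "l < dim_vec (0\<^sub>v r :: real vec)"
    thus "(D *\<^sub>v x) $ l = 0\<^sub>v r $ l"
      using a0[of l] D by simp
  qed (use D in simp)
  moreover have "C *\<^sub>v 0\<^sub>v r = 0\<^sub>v m"
    using C by (intro eq_vecI) auto
  ultimately have "(C * D) *\<^sub>v x = 0\<^sub>v m"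
    using C D x by (simp add: assoc_mult_mat_vec[of _ m r _ n])
  hence Bx: "B *\<^sub>v x = Z *\<^sub>v x"
    using A Z x by (simp add: B add_mult_distrib_mat_vec[of _ m n])
  have z0: "col V' l \<bullet> x = 0" if "l < k" for l
    using a0[of "r + l"] that by simp
  have norm_x: "x \<bullet> x = (\<Sum>j\<in>J. (c j)\<^sup>2)"
    unfolding x_def by (rule norm_orthonormal_comb[OF v J(1)])
  obtain j0 where j0: "j0 \<in> J" "c j0 \<noteq> 0"
    using c(1) by blast
  have "0 < (c j0)\<^sup>2"
    using j0 by simp
  also have "\<dots> \<le> x \<bullet> x"
    unfolding norm_x using J j0 by (intro member_le_sum) auto
  finally have x_pos: "0 < x \<bullet> x" .
  have "(s ! (r + k))\<^sup>2 * (x \<bullet> x) = (\<Sum>j\<in>J. (s ! (r + k))\<^sup>2 * (c j)\<^sup>2)"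
    by (simp add: norm_x sum_distrib_left)
  also have "\<dots> \<le> (\<Sum>j\<in>J. (s ! j)\<^sup>2 * (col V j \<bullet> x)\<^sup>2)"
  proof (rule sum_mono)
    fix j assume j: "j \<in> J"
    have "col V j \<bullet> x = c j"
      unfolding x_def by (rule scalar_prod_orthonormal_comb[OF v J(1) j])
    moreover have "(s ! (r + k))\<^sup>2 \<le> (s ! j)\<^sup>2"
      using sB(1)[of j "r + k"] sB(2)[of "r + k"] k j by (intro power_mono) (auto simp: J_def)
    ultimately show "(s ! (r + k))\<^sup>2 * (c j)\<^sup>2 \<le> (s ! j)\<^sup>2 * (col V j \<bullet> x)\<^sup>2"
      by (simp add: mult_right_mono)
  qed
  also have "\<dots> \<le> (\<Sum>j<min m n. (s ! j)\<^sup>2 * (col V j \<bullet> x)\<^sup>2)"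
    using k by (intro sum_mono2) (auto simp: J_def)
  also have "\<dots> = (Z *\<^sub>v x) \<bullet> (Z *\<^sub>v x)"
    using svd_norm_mult_vec[OF svdB Bc x] Bx by simp
  also have "\<dots> = (\<Sum>l<min m n. (s' ! l)\<^sup>2 * (col V' l \<bullet> x)\<^sup>2)"
    by (rule svd_norm_mult_vec[OF svdZ Z x])
  also have "\<dots> \<le> (\<Sum>l<min m n. (s' ! k)\<^sup>2 * (col V' l \<bullet> x)\<^sup>2)"
  proof (rule sum_mono)
    fix l assume "l \<in> {..<min m n}"
    hence "(s' ! l)\<^sup>2 \<le> (s' ! k)\<^sup>2" if "\<not> l < k"
      using sZ(1)[of k l] sZ(2)[of l] that by (intro power_mono) auto
    thus "(s' ! l)\<^sup>2 * (col V' l \<bullet> x)\<^sup>2 \<le> (s' ! k)\<^sup>2 * (col V' l \<bullet> x)\<^sup>2"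
      using z0[of l] by (cases "l < k") (auto simp: mult_right_mono)
  qed
  also have "\<dots> \<le> (\<Sum>l<n. (s' ! k)\<^sup>2 * (col V' l \<bullet> x)\<^sup>2)"
    by (intro sum_mono2) auto
  also have "\<dots> = (s' ! k)\<^sup>2 * (x \<bullet> x)"
    by (simp only: parseval_identity[OF V' x] flip: sum_distrib_left)
  finally have "(s ! (r + k))\<^sup>2 \<le> (s' ! k)\<^sup>2"
    by (rule mult_right_le_imp_le[OF _ x_pos])
  moreover have "0 \<le> s' ! k"
    using k by (intro sZ(2)) simp
  ultimately show ?thesis
    by (rule power2_le_imp_le)
qed

text \<open>
  If the bilinear form of \<open>C * D\<close> is diagonal with nonzero entries on two families of vectors, these have
  at most as many members as the inner dimension \<open>r\<close>: otherwise \<open>D\<close> would vanish on a nontrivial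
  combination of the \<open>v i\<close>.
\<close>
lemma orthonormal_family_card_le_rank:
  fixes C D :: "real mat"
  assumes C: "C \<in> carrier_mat m r" and D: "D \<in> carrier_mat r n" and I: "finite I"
    and u: "\<And>i. i \<in> I \<Longrightarrow> u i \<in> carrier_vec m" and v: "\<And>i. i \<in> I \<Longrightarrow> v i \<in> carrier_vec n"
    and \<sigma>: "\<And>i. i \<in> I \<Longrightarrow> \<sigma> i \<noteq> 0"
    and diag: "\<And>i j. i \<in> I \<Longrightarrow> j \<in> I \<Longrightarrow> u j \<bullet> ((C * D) *\<^sub>v v i) = (if i = j then \<sigma> i else 0)"
  shows "card I \<le> r"
proof (rule ccontr)
  assume "\<not> card I \<le> r"
  then obtain c where c: "\<exists>i\<in>I. c i \<noteq> 0" "\<forall>l<r. (\<Sum>i\<in>I. (row D l \<bullet> v i) * c i) = 0"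
    using homogeneous_system_nontrivial[of I r "\<lambda>l i. row D l \<bullet> v i"] I by auto
  define x where "x = vec_comb n I c v"
  have x: "x \<in> carrier_vec n"
    by (simp add: x_def)
  have "D *\<^sub>v x = 0\<^sub>v r"
  proof (rule eq_vecI)
    fix l assume "l < dim_vec (0\<^sub>v r :: real vec)"
    hence l: "l < r"
      by simp
    have "row D l \<bullet> x = (\<Sum>i\<in>I. c i * (row D l \<bullet> v i))"
      unfolding x_def using D l v by (intro scalar_prod_vec_comb) auto
    thus "(D *\<^sub>v x) $ l = 0\<^sub>v r $ l"
      using c(2) l D by (simp add: mult.commute)
  qed (use D in simp)
  moreover have "C *\<^sub>v 0\<^sub>v r = 0\<^sub>v m"
    using C by (intro eq_vecI) auto
  ultimately have Ax: "(C * D) *\<^sub>v x = 0\<^sub>v m"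
    using C D x by (simp add: assoc_mult_mat_vec[of _ m r _ n])
  obtain j where j: "j \<in> I" "c j \<noteq> 0"
    using c(1) by blast
  have "0 = u j \<bullet> ((C * D) *\<^sub>v x)"
    using u[OF j(1)] by (simp add: Ax)
  also have "\<dots> = u j \<bullet> vec_comb m I c (\<lambda>i. (C * D) *\<^sub>v v i)"
    unfolding x_def using C D v by (subst mult_mat_vec_comb[of _ m n]) auto
  also have "\<dots> = (\<Sum>i\<in>I. c i * (u j \<bullet> ((C * D) *\<^sub>v v i)))"
    using u[OF j(1)] v C D by (intro scalar_prod_vec_comb) auto
  also have "\<dots> = (\<Sum>i\<in>I. if i = j then c j * \<sigma> j else 0)"
    using diag j by (intro sum.cong) auto
  also have "\<dots> = c j * \<sigma> j"
    using I j by simp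
  finally show False
    using j \<sigma>[OF j(1)] by simp
qed

section \<open>The bound for compressions\<close>

text \<open>
  The core estimate, for \<open>\<sigma> i = x i - y i\<close> where \<open>x i\<close> and \<open>y i\<close> are the values at \<open>u i\<close> and \<open>v i\<close> of the
  bilinear forms of \<open>B\<close> and \<open>Z\<close>. By \<open>orth\<close>, only the singular values of \<open>B\<close> from number \<open>r + 1\<close> on
  contribute to \<open>x i\<close>.
\<close>
lemma residual_singular_values_bound:
  assumes C: "C \<in> carrier_mat m r" and D: "D \<in> carrier_mat r n" and Z: "Z \<in> carrier_mat m n"
    and B: "B = C * D + Z" and svdB: "is_svd B U s V" and svdZ: "is_svd Z U' s' V'"
    and r: "0 < r" "r \<le> min m n" and I: "finite I"
    and u: "orthonormal_family m I u" and v: "orthonormal_family n I v"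
    and \<sigma>: "\<And>i. i \<in> I \<Longrightarrow> 0 < \<sigma> i"
    and diag: "\<And>i j. i \<in> I \<Longrightarrow> j \<in> I \<Longrightarrow> u j \<bullet> ((C * D) *\<^sub>v v i) = (if i = j then \<sigma> i else 0)"
    and orth: "\<And>i k. i \<in> I \<Longrightarrow> k < r \<Longrightarrow> col U k \<bullet> u i = 0 \<or> col V k \<bullet> v i = 0"
  shows "1 \<le> q \<Longrightarrow> (\<Sum>i\<in>I. \<sigma> i powr q) \<le> 2 powr q * (\<Sum>k<r. (s' ! k) powr q)"
    and "i \<in> I \<Longrightarrow> \<sigma> i \<le> 2 * s' ! 0"
proof -
  define N where "N = min m n"
  have A: "C * D \<in> carrier_mat m n" and Bc: "B \<in> carrier_mat m n"
    using C D Z B by auto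
  have U: "U \<in> carrier_mat m m" "orthonormal_cols U" and V: "V \<in> carrier_mat n n" "orthonormal_cols V"
    and U': "U' \<in> carrier_mat m m" "orthonormal_cols U'" and V': "V' \<in> carrier_mat n n" "orthonormal_cols V'"
    using svdB svdZ Bc Z by (auto simp: is_svd_def)
  note sB = svd_values[OF svdB Bc, folded N_def] and sZ = svd_values[OF svdZ Z, folded N_def]
  note uD = orthonormal_familyD[OF u] and vD = orthonormal_familyD[OF v]
  have card: "card I \<le> r"
    using \<sigma> uD vD diag by (intro orthonormal_family_card_le_rank[OF C D I, of u v \<sigma>]) force+
  have weyl: "s ! (r + k) \<le> s' ! k" if "r + k < N" for k
    using singular_value_low_rank_perturbation[OF C D Z B svdB svdZ] that by (simp add: N_def)

  have row_le: "(\<Sum>k\<in>K. (col W k \<bullet> x)\<^sup>2) \<le> 1"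
    if "W \<in> carrier_mat d d" "orthonormal_cols W" "x \<in> carrier_vec d" "x \<bullet> x = 1" "K \<subseteq> {..<d}" for W d x K
  proof -
    have "(\<Sum>k\<in>K. (col W k \<bullet> x)\<^sup>2) \<le> (\<Sum>k<d. (col W k \<bullet> x)\<^sup>2)"
      using that(5) by (intro sum_mono2) auto
    thus ?thesis
      using parseval_identity[OF that(1-3)] that(4) by simp
  qed
  have col_le: "(\<Sum>i\<in>I. (col W k \<bullet> f i)\<^sup>2) \<le> 1"
    if "W \<in> carrier_mat d d" "orthonormal_cols W" "orthonormal_family d I f" "k < d" for W d k f
  proof -
    have W: "orthonormal_family d {..<d} (col W)"
      by (rule orthonormal_cols_family[OF that(1,2)])
    have "(\<Sum>i\<in>I. (col W k \<bullet> f i)\<^sup>2) = (\<Sum>i\<in>I. (f i \<bullet> col W k)\<^sup>2)"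
      using that(1,4) orthonormal_familyD(1)[OF that(3)]
      by (intro sum.cong refl arg_cong[of _ _ "\<lambda>x. x\<^sup>2"] comm_scalar_prod[of _ d]) auto
    also have "\<dots> \<le> col W k \<bullet> col W k"
      using that(1,3) I by (intro bessel_inequality) auto
    finally show ?thesis
      using orthonormal_familyD(2)[OF W] that(4) by simp
  qed

  define x where "x = (\<lambda>i. \<Sum>k<N - r. s ! (r + k) * (col U (r + k) \<bullet> u i) * (col V (r + k) \<bullet> v i))"
  define y where "y = (\<lambda>i. \<Sum>k<N. s' ! k * (col U' k \<bullet> u i) * (col V' k \<bullet> v i))"
  have \<sigma>_eq: "\<sigma> i = x i - y i" if i: "i \<in> I" for i
  proof -
    have "u i \<bullet> (B *\<^sub>v v i) = (\<Sum>k<N. s ! k * (col U k \<bullet> u i) * (col V k \<bullet> v i))"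
      unfolding N_def by (rule svd_bilinear[OF svdB Bc uD(1)[OF i] vD(1)[OF i]])
    also have "\<dots> = (\<Sum>k\<in>{r..<N}. s ! k * (col U k \<bullet> u i) * (col V k \<bullet> v i))"
    proof (rule sum.mono_neutral_right)
      show "\<forall>k\<in>{..<N} - {r..<N}. s ! k * (col U k \<bullet> u i) * (col V k \<bullet> v i) = 0"
        using orth[OF i] by fastforce
    qed auto
    also have "\<dots> = x i"
      using r sum.shift_bounds_nat_ivl[of "\<lambda>k. s ! k * (col U k \<bullet> u i) * (col V k \<bullet> v i)" 0 r "N - r"]
      by (simp add: x_def N_def add.commute atLeast0LessThan)
    finally have "u i \<bullet> (B *\<^sub>v v i) = x i" .
    moreover have "u i \<bullet> (Z *\<^sub>v v i) = y i"
      unfolding y_def N_def by (rule svd_bilinear[OF svdZ Z uD(1)[OF i] vD(1)[OF i]])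
    moreover have "u i \<bullet> (B *\<^sub>v v i) = u i \<bullet> ((C * D) *\<^sub>v v i) + u i \<bullet> (Z *\<^sub>v v i)"
      using A Z uD(1)[OF i] vD(1)[OF i]
      by (simp add: B add_mult_distrib_mat_vec[of _ m n] scalar_prod_add_distrib[of _ m])
    ultimately show ?thesis
      using diag[OF i i] by simp
  qed

  have shift_row: "(\<Sum>k<N - r. (col W (r + k) \<bullet> z)\<^sup>2) \<le> 1"
    if "W \<in> carrier_mat d d" "orthonormal_cols W" "z \<in> carrier_vec d" "z \<bullet> z = 1" "N \<le> d" for W d z
  proof -
    have "(\<Sum>k<N - r. (col W (r + k) \<bullet> z)\<^sup>2) = (\<Sum>k\<in>{r..<N}. (col W k \<bullet> z)\<^sup>2)"
      using r sum.shift_bounds_nat_ivl[of "\<lambda>k. (col W k \<bullet> z)\<^sup>2" 0 r "N - r"]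
      by (simp add: N_def add.commute atLeast0LessThan)
    also have "\<dots> \<le> 1"
      using that by (intro row_le) auto
    finally show ?thesis .
  qed
  have N: "N \<le> m" "N \<le> n" "r \<le> N"
    using r by (auto simp: N_def)

  show "(\<Sum>i\<in>I. \<sigma> i powr q) \<le> 2 powr q * (\<Sum>k<r. (s' ! k) powr q)" if q: "1 \<le> q"
  proof -
    have "(\<Sum>i\<in>I. \<bar>x i\<bar> powr q) \<le> (\<Sum>k<min r (N - r). (s ! (r + k)) powr q)"
      unfolding x_def
      using q I card sB uD vD U V u v N
      by (intro sum_powr_bilinear_le shift_row[of _ m] shift_row[of _ n] col_le[of _ m] col_le[of _ n]) auto
    also have "\<dots> \<le> (\<Sum>k<min r (N - r). (s' ! k) powr q)"
      using q weyl sB(2) by (intro sum_mono powr_mono2) auto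
    also have "\<dots> \<le> (\<Sum>k<r. (s' ! k) powr q)"
      by (intro sum_mono2) auto
    finally have X: "(\<Sum>i\<in>I. \<bar>x i\<bar> powr q) \<le> (\<Sum>k<r. (s' ! k) powr q)" .
    have "(\<Sum>i\<in>I. \<bar>y i\<bar> powr q) \<le> (\<Sum>k<min r N. (s' ! k) powr q)"
      unfolding y_def
      using q I card sZ uD vD U' V' u v N
      by (intro sum_powr_bilinear_le row_le[of _ m] row_le[of _ n] col_le[of _ m] col_le[of _ n]) auto
    hence Y: "(\<Sum>i\<in>I. \<bar>y i\<bar> powr q) \<le> (\<Sum>k<r. (s' ! k) powr q)"
      using N by (simp add: min_absorb1)
    have "(\<Sum>i\<in>I. \<sigma> i powr q) = (\<Sum>i\<in>I. \<bar>x i - y i\<bar> powr q)"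
      using \<sigma> by (intro sum.cong) (auto simp: abs_of_pos simp flip: \<sigma>_eq)
    also have "\<dots> \<le> (\<Sum>i\<in>I. 2 powr q * ((\<bar>x i\<bar> powr q + \<bar>y i\<bar> powr q) / 2))"
      using q by (intro sum_mono powr_diff_le)
    also have "\<dots> = 2 powr q * (((\<Sum>i\<in>I. \<bar>x i\<bar> powr q) + (\<Sum>i\<in>I. \<bar>y i\<bar> powr q)) / 2)"
      by (simp add: sum.distrib flip: sum_distrib_left sum_divide_distrib)
    also have "\<dots> \<le> 2 powr q * (\<Sum>k<r. (s' ! k) powr q)"
      using X Y by (intro mult_left_mono) auto
    finally show ?thesis .
  qed

  show "\<sigma> i \<le> 2 * s' ! 0" if i: "i \<in> I"
  proof -
    have s'0: "0 \<le> s' ! 0"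
      using sZ(2)[of 0] r N by auto
    have "s ! (r + k) \<le> s' ! 0" if "k < N - r" for k
    proof -
      have "r + k < N" "k < N"
        using that by auto
      thus ?thesis
        using weyl[of k] sZ(1)[of 0 k] by simp
    qed
    hence "\<bar>x i\<bar> \<le> s' ! 0"
      unfolding x_def using sB(2) uD(1,2)[OF i] vD(1,2)[OF i] U V N s'0
      by (intro abs_bilinear_le shift_row[of _ m] shift_row[of _ n]) auto
    moreover have "\<bar>y i\<bar> \<le> s' ! 0"
      unfolding y_def using sZ uD(1,2)[OF i] vD(1,2)[OF i] U' V' N s'0
      by (intro abs_bilinear_le row_le[of _ m] row_le[of _ n]) auto
    ultimately show ?thesis
      using \<sigma>_eq[OF i] by linarith
  qed
qed

lemma proj_onto_orthogonal_complement:
  assumes U: "U \<in> carrier_mat m r" and W: "W \<in> carrier_mat m p" and orth: "orthonormal_cols (append_cols U W)"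
  shows "(proj_onto W)\<^sup>T = proj_onto W" and "proj_onto W * proj_onto W = proj_onto W"
    and "k < r \<Longrightarrow> proj_onto W *\<^sub>v col (append_cols U W) k = 0\<^sub>v m"
proof -
  let ?Q = "append_cols U W"
  have Q: "?Q \<in> carrier_mat m (r + p)"
    using U W by (auto simp: append_cols_def)
  have cW: "col ?Q (r + k) = col W k" if "k < p" for k
    using U W that by (intro eq_vecI) (auto simp: append_cols_def)
  note onf = orthonormal_cols_family[OF Q orth]
  show "(proj_onto W)\<^sup>T = proj_onto W"
    using W by (simp add: proj_onto_def transpose_mult[of _ m p _ m])
  have WW: "W\<^sup>T * W = 1\<^sub>m p"
  proof (rule eq_matI)
    fix i j assume "i < dim_row (1\<^sub>m p :: real mat)" "j < dim_col (1\<^sub>m p :: real mat)"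
    thus "(W\<^sup>T * W) $$ (i, j) = 1\<^sub>m p $$ (i, j)"
      using W cW[of i] cW[of j] orthonormal_familyD(3)[OF onf, of "r + i" "r + j"] by auto
  qed (use W in auto)
  have "proj_onto W * proj_onto W = W * ((W\<^sup>T * W) * W\<^sup>T)"
    using W by (simp add: proj_onto_def assoc_mult_mat[of _ m p _ m _ m] assoc_mult_mat[of _ p m _ p _ m])
  thus "proj_onto W * proj_onto W = proj_onto W"
    using W by (simp add: WW proj_onto_def left_mult_one_mat[of _ p m])
  show "proj_onto W *\<^sub>v col ?Q k = 0\<^sub>v m" if k: "k < r"
  proof -
    have "col ?Q k \<in> carrier_vec m"
      using Q by (intro carrier_vecI) simp
    moreover have "W\<^sup>T *\<^sub>v col ?Q k = 0\<^sub>v p"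
    proof (rule eq_vecI)
      fix l assume "l < dim_vec (0\<^sub>v p :: real vec)"
      thus "(W\<^sup>T *\<^sub>v col ?Q k) $ l = 0\<^sub>v p $ l"
        using W cW[of l] orthonormal_familyD(3)[OF onf, of "r + l" k] k by auto
    qed (use W in simp)
    moreover have "W *\<^sub>v 0\<^sub>v p = 0\<^sub>v m"
      using W by (intro eq_vecI) auto
    ultimately show ?thesis
      using W by (simp add: proj_onto_def assoc_mult_mat_vec[of _ m p _ m])
  qed
qed

lemma schatten_norm_svd_trunc:
  assumes svd: "is_svd Z U s V" and Z: "Z \<in> carrier_mat m n" and r: "0 < r" "r \<le> min m n"
  shows "schatten_norm \<infinity> (svd_trunc r U s V) = s ! 0"
    and "schatten_norm (ereal p) (svd_trunc r U s V) = (\<Sum>k<r. (s ! k) powr p) powr (1 / p)"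
proof -
  have len: "length s = min m n"
    using svd Z by (auto simp: is_svd_def)
  have sv: "singular_values (svd_trunc r U s V) = take r s @ replicate (min m n - r) 0"
    by (rule singular_values_svd_trunc[OF svd Z r(2)])
  show "schatten_norm \<infinity> (svd_trunc r U s V) = s ! 0"
    using r len by (simp add: schatten_norm_def sv nth_append)
  have "(\<Sum>x\<leftarrow>take r s. x powr p) = (\<Sum>k<r. (s ! k) powr p)"
    using r len by (simp add: sum_list_sum_nth atLeast0LessThan)
  thus "schatten_norm (ereal p) (svd_trunc r U s V) = (\<Sum>k<r. (s ! k) powr p) powr (1 / p)"
    by (simp add: schatten_norm_def sv sum_list_replicate)
qed

text \<open>
  The compression \<open>P * A * Q\<close> by orthogonal projections, one of which annihilates the leading \<open>r\<close>
  singular vectors of \<open>B\<close> on its side. The other one is the identity in the applications.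
\<close>
lemma schatten_norm_compression_le:
  assumes A: "A \<in> carrier_mat m n" and Z: "Z \<in> carrier_mat m n" and B: "B = A + Z"
    and rank: "vec_space.rank m A = r" and r: "0 < r" "r \<le> min m n"
    and svdB: "is_svd B U s V" and svdZ: "is_svd Z U' s' V'"
    and P: "P \<in> carrier_mat m m" "P\<^sup>T = P" "P * P = P" and Q: "Q \<in> carrier_mat n n" "Q\<^sup>T = Q" "Q * Q = Q"
    and kill: "(\<forall>k<r. P *\<^sub>v col U k = 0\<^sub>v m) \<or> (\<forall>k<r. Q *\<^sub>v col V k = 0\<^sub>v n)"
    and q: "1 \<le> q"
  shows "schatten_norm q (P * A * Q) \<le> 2 * schatten_norm q (svd_trunc r U' s' V')"
proof -
  obtain C D where C: "C \<in> carrier_mat m r" and D: "D \<in> carrier_mat r n" and A_eq: "A = C * D"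
    using rank_factorization[OF A rank] by blast
  define M where "M = P * A * Q"
  have M: "M \<in> carrier_mat m n"
    using P Q A by (simp add: M_def)
  have U: "U \<in> carrier_mat m m" and V: "V \<in> carrier_mat n n"
    using svdB A Z B by (auto simp: is_svd_def)
  have M_vec: "M *\<^sub>v y = P *\<^sub>v (A *\<^sub>v (Q *\<^sub>v y))" if "y \<in> carrier_vec n" for y
    using that P Q A unfolding M_def
    by (simp add: assoc_mult_mat_vec[of _ m n _ n] assoc_mult_mat_vec[of _ m m _ n])
  have MT_vec: "M\<^sup>T *\<^sub>v y = Q *\<^sub>v (A\<^sup>T *\<^sub>v (P *\<^sub>v y))" if "y \<in> carrier_vec m" for y
  proof -
    have "M\<^sup>T = Q * (A\<^sup>T * P)"
      using P Q A unfolding M_def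
      by (simp add: transpose_mult[of _ m n _ n] transpose_mult[of _ m m _ n])
    thus ?thesis
      using that P Q A
      by (simp add: assoc_mult_mat_vec[of _ n n _ m] assoc_mult_mat_vec[of _ n m _ m])
  qed
  obtain I :: "nat set" and u v \<sigma> where I: "finite I"
    and u: "orthonormal_family m I u" and v: "orthonormal_family n I v"
    and \<sigma>: "\<And>i. i \<in> I \<Longrightarrow> 0 < \<sigma> i"
    and Mv: "\<And>i. i \<in> I \<Longrightarrow> M *\<^sub>v v i = \<sigma> i \<cdot>\<^sub>v u i" and Mu: "\<And>i. i \<in> I \<Longrightarrow> M\<^sup>T *\<^sub>v u i = \<sigma> i \<cdot>\<^sub>v v i"
    and len_sv: "length (singular_values M) = min m n"
    and set_sv: "set (singular_values M) \<subseteq> insert 0 (\<sigma> ` I)"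
    and sum_sv: "\<And>p. (\<Sum>x\<leftarrow>singular_values M. x powr p) \<le> (\<Sum>i\<in>I. \<sigma> i powr p)"
    using singular_system_exists[OF M] by blast
  have uc: "u i \<in> carrier_vec m" and vc: "v i \<in> carrier_vec n" if "i \<in> I" for i
    using u v that by (auto simp: orthonormal_family_def)
  have fixed: "E *\<^sub>v x = x"
    if "E \<in> carrier_mat d d" "E * E = E" "x \<in> carrier_vec d" "y \<in> carrier_vec d" "E *\<^sub>v y = a \<cdot>\<^sub>v x" "0 < a"
    for E :: "real mat" and d x y a
  proof -
    have "x = (1 / a) \<cdot>\<^sub>v (E *\<^sub>v y)"
      using that by (simp add: smult_smult_assoc)
    moreover have "E *\<^sub>v ((1 / a) \<cdot>\<^sub>v (E *\<^sub>v y)) = (1 / a) \<cdot>\<^sub>v ((E * E) *\<^sub>v y)"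
      using that(1,4) by (simp add: mult_mat_vec[of _ d d] assoc_mult_mat_vec[of _ d d _ d])
    ultimately show ?thesis
      using that(2) by simp
  qed
  \<comment> \<open>The singular vectors of \<open>M\<close> lie in the ranges of \<open>P\<close> and \<open>Q\<close>.\<close>
  have Pu: "P *\<^sub>v u i = u i" if "i \<in> I" for i
    using P Q A uc vc \<sigma> Mv M_vec that
    by (intro fixed[of _ m _ "A *\<^sub>v (Q *\<^sub>v v i)" "\<sigma> i"]) auto
  have Qv: "Q *\<^sub>v v i = v i" if "i \<in> I" for i
    using P Q A uc vc \<sigma> Mu MT_vec that
    by (intro fixed[of _ n _ "A\<^sup>T *\<^sub>v (P *\<^sub>v u i)" "\<sigma> i"]) auto
  have diag: "u j \<bullet> ((C * D) *\<^sub>v v i) = (if i = j then \<sigma> i else 0)" if "i \<in> I" "j \<in> I" for i j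
  proof -
    have "u j \<bullet> (M *\<^sub>v v i) = u j \<bullet> (P *\<^sub>v (A *\<^sub>v v i))"
      using M_vec[OF vc[OF that(1)]] Qv[OF that(1)] by simp
    also have "\<dots> = (P *\<^sub>v u j) \<bullet> (A *\<^sub>v v i)"
      using transpose_vec_mult_scalar[of P m m "A *\<^sub>v v i" "u j"] P A uc[OF that(2)] vc[OF that(1)]
      by simp
    also have "\<dots> = u j \<bullet> ((C * D) *\<^sub>v v i)"
      using Pu[OF that(2)] by (simp add: A_eq)
    finally show ?thesis
      using that u uc
      by (auto simp: Mv orthonormal_family_def scalar_prod_smult_distrib[of _ m] split: if_splits)
  qed
  have kill0: "z \<bullet> x = 0"
    if "E \<in> carrier_mat d d" "E\<^sup>T = E" "E *\<^sub>v x = x" "E *\<^sub>v z = 0\<^sub>v d" "x \<in> carrier_vec d" "z \<in> carrier_vec d"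
    for E :: "real mat" and d x z
    using transpose_vec_mult_scalar[of E d d x z] that by simp
  have orth: "col U k \<bullet> u i = 0 \<or> col V k \<bullet> v i = 0" if "i \<in> I" "k < r" for i k
    using kill kill0[OF P(1,2) Pu, of i "col U k"] kill0[OF Q(1,2) Qv, of i "col V k"]
      that uc vc U V by auto
  note bound = residual_singular_values_bound[OF C D Z B[unfolded A_eq] svdB svdZ r I u v \<sigma> diag orth]
  have "schatten_norm q M \<le> 2 * schatten_norm q (svd_trunc r U' s' V')"
  proof (cases "q = \<infinity>")
    case True
    have "singular_values M ! 0 \<in> set (singular_values M)"
      using len_sv r by (intro nth_mem) auto
    moreover have "0 \<le> s' ! 0"
      using svd_values(2)[OF svdZ Z, of 0] r by auto
    ultimately have "singular_values M ! 0 \<le> 2 * s' ! 0"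
      using set_sv bound(2) by auto
    moreover have "schatten_norm q M = singular_values M ! 0"
      by (simp add: schatten_norm_def True)
    ultimately show ?thesis
      unfolding True by (simp add: schatten_norm_svd_trunc(1)[OF svdZ Z r])
  next
    case False
    then obtain p where p: "q = ereal p" "1 \<le> p"
      using q by (cases q) auto
    have "schatten_norm q M = (\<Sum>x\<leftarrow>singular_values M. x powr p) powr (1 / p)"
      by (simp add: schatten_norm_def p)
    also have "\<dots> \<le> (2 powr p * (\<Sum>k<r. (s' ! k) powr p)) powr (1 / p)"
      using p order_trans[OF sum_sv bound(1)] by (intro powr_mono2 sum_list_nonneg) auto
    also have "\<dots> = 2 * schatten_norm q (svd_trunc r U' s' V')"
      using p(2) by (simp add: p(1) schatten_norm_svd_trunc(2)[OF svdZ Z r] powr_mult powr_powr)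
    finally show ?thesis .
  qed
  thus ?thesis
    by (simp add: M_def)
qed

theorem theorem2:
  fixes m n r :: nat and q :: ereal
    and A B Z U U\<^sub>p V V\<^sub>p U\<^sub>Z V\<^sub>Z :: "real mat" and s\<^sub>B s\<^sub>Z :: "real list"
  assumes "0 < m" and "0 < n" and "0 < r" and "r \<le> min m n"
    and "A \<in> carrier_mat m n" and "Z \<in> carrier_mat m n" and "B = A + Z"
    and "vec_space.rank m A = r"
    and "U \<in> carrier_mat m r" and "U\<^sub>p \<in> carrier_mat m (m - r)"
    and "V \<in> carrier_mat n r" and "V\<^sub>p \<in> carrier_mat n (n - r)"
    and "is_svd B (append_cols U U\<^sub>p) s\<^sub>B (append_cols V V\<^sub>p)"
    and "is_svd Z U\<^sub>Z s\<^sub>Z V\<^sub>Z"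
    and "1 \<le> q"
  shows "max (schatten_norm q (proj_onto U\<^sub>p * A)) (schatten_norm q (A * proj_onto V\<^sub>p))
           \<le> 2 * schatten_norm q (svd_trunc r U\<^sub>Z s\<^sub>Z V\<^sub>Z)"
proof -
  have orth: "orthonormal_cols (append_cols U U\<^sub>p)" "orthonormal_cols (append_cols V V\<^sub>p)"
    using assms(13) by (auto simp: is_svd_def)
  note PU = proj_onto_orthogonal_complement[OF assms(9,10) orth(1)]
    and PV = proj_onto_orthogonal_complement[OF assms(11,12) orth(2)]
  have carrier: "proj_onto U\<^sub>p \<in> carrier_mat m m" "proj_onto V\<^sub>p \<in> carrier_mat n n"
    using assms(10,12) by (auto simp: proj_onto_def)
  note bound = schatten_norm_compression_le[OF assms(5-8,3,4,13,14) _ _ _ _ _ _ _ assms(15)]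
  have "schatten_norm q (proj_onto U\<^sub>p * A * 1\<^sub>m n) \<le> 2 * schatten_norm q (svd_trunc r U\<^sub>Z s\<^sub>Z V\<^sub>Z)"
    using carrier PU by (intro bound) auto
  moreover have "schatten_norm q (1\<^sub>m m * A * proj_onto V\<^sub>p) \<le> 2 * schatten_norm q (svd_trunc r U\<^sub>Z s\<^sub>Z V\<^sub>Z)"
    using carrier PV by (intro bound) auto
  ultimately show ?thesis
    using assms(5) carrier by (simp add: right_mult_one_mat[of _ m n] left_mult_one_mat[of _ m n])
qed

end
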